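(* Let $I$ be a proper graded ideal in an $\mathbb{N}$-graded Noetherian domain $R$. If $I$ has the symbolic strong persistence property, then $$\mathrm{v}(I^{(k)})\le (k-1)\,d(I^{(1)})+\mathrm{v}(I^{(1)})\quad\text{for all }k\ge 1.$$
   Context: $\mathbb{N}$ is the set of non-negative integers; rings are commutative with unity. The $k$-th symbolic power $I^{(k)}$ of an ideal $I$ of a Noetherian ring $R$ is defined by one of the following two conventions: (1) $I^{(k)}=\bigcap_{P\in\mathrm{Ass}(R/I)}(I^kR_P\cap R)$; (2) $I^{(k)}=\bigcap_{P\in\mathrm{Min}(I)}(I^kR_P\cap R)$, where $\mathrm{Min}(I)$ is the set of minimal primes of $I$. The result is asserted for either convention (the same convention being used throughout the statement). Set $I^{(0)}=R$. $I$ has the symbolic strong persistence property if $(I^{(k)}:I^{(1)})=I^{(k-1)}$ for all $k\ge 1$. For a nonzero graded ideal $J$, $d(J)$ denotes the maximum degree of an element of a minimal homogeneous generating set of $J$. For a proper graded ideal $J$, the v-number is $\mathrm{v}(J)=\min\{d\ge 0\mid \exists f\in R_d,\ \mathfrak{p}\in\mathrm{Ass}(J)\text{ with }(J:f)=\mathfrak{p}\}$, where $\mathrm{Ass}(J)$ is the set of associated primes of $R/J$. *)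

theory Defs
  imports "HOL-Algebra.Ring_Divisibility" "HOL-Algebra.Ideal_Product" "HOL-Algebra.Module"
begin

section \<open>Graded rings and graded ideals\<close>

text \<open>\<open>c\<close> is a family of components, \<open>c d \<in> B d\<close> and almost all \<open>c d\<close> zero, whose sum is \<open>x\<close>.\<close>

definition component_family ::
    "('a, 'b) ring_scheme \<Rightarrow> (nat \<Rightarrow> 'a set) \<Rightarrow> 'a \<Rightarrow> (nat \<Rightarrow> 'a) \<Rightarrow> bool" where
  "component_family R B x c \<longleftrightarrow>
     (\<forall>d. c d \<in> B d) \<and> finite {d. c d \<noteq> \<zero>\<^bsub>R\<^esub>} \<and>
     x = (\<Oplus>\<^bsub>R\<^esub>d\<in>{d. c d \<noteq> \<zero>\<^bsub>R\<^esub>}. c d)"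

definition graded_ring :: "('a, 'b) ring_scheme \<Rightarrow> (nat \<Rightarrow> 'a set) \<Rightarrow> bool" where
  "graded_ring R A \<longleftrightarrow>
     cring R \<and>
     (\<forall>d. additive_subgroup (A d) R) \<and>
     (\<forall>x\<in>carrier R. \<exists>!c. component_family R A x c) \<and>
     (\<forall>i j. \<forall>x\<in>A i. \<forall>y\<in>A j. x \<otimes>\<^bsub>R\<^esub> y \<in> A (i + j))"

text \<open>An ideal \<open>I\<close> is graded if \<open>I\<close> is the (automatically direct) sum of the \<open>I \<inter> A d\<close>.\<close>

definition graded_ideal :: "('a, 'b) ring_scheme \<Rightarrow> (nat \<Rightarrow> 'a set) \<Rightarrow> 'a set \<Rightarrow> bool" where
  "graded_ideal R A I \<longleftrightarrow>
     ideal I R \<and> (\<forall>x\<in>I. \<exists>c. component_family R (\<lambda>d. I \<inter> A d) x c)"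


section \<open>Localization\<close>

text \<open>For a multiplicative set \<open>S\<close> of \<open>R\<close>: the ring of fractions \<open>S\<^sup>-\<^sup>1R\<close>, whose elements are classes of
  pairs \<open>(a, s)\<close> with \<open>s \<in> S\<close>.\<close>

definition fraction_rel ::
    "('a, 'b) ring_scheme \<Rightarrow> 'a set \<Rightarrow> (('a \<times> 'a) \<times> ('a \<times> 'a)) set" where
  "fraction_rel R S =
     {((a, s), (b, t)). a \<in> carrier R \<and> b \<in> carrier R \<and> s \<in> S \<and> t \<in> S \<and>
        (\<exists>u\<in>S. u \<otimes>\<^bsub>R\<^esub> (a \<otimes>\<^bsub>R\<^esub> t \<ominus>\<^bsub>R\<^esub> b \<otimes>\<^bsub>R\<^esub> s) = \<zero>\<^bsub>R\<^esub>)}"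

definition fraction :: "('a, 'b) ring_scheme \<Rightarrow> 'a set \<Rightarrow> 'a \<Rightarrow> 'a \<Rightarrow> ('a \<times> 'a) set" where
  "fraction R S a s = fraction_rel R S `` {(a, s)}"

text \<open>The operations are the usual ones on representatives; the unions range over a single class
  because the result does not depend on the representatives.\<close>

definition localization :: "('a, 'b) ring_scheme \<Rightarrow> 'a set \<Rightarrow> ('a \<times> 'a) set ring" where
  "localization R S =
     \<lparr>carrier = (carrier R \<times> S) // fraction_rel R S,
      monoid.mult = (\<lambda>x y. \<Union>(a, s)\<in>x. \<Union>(b, t)\<in>y. fraction R S (a \<otimes>\<^bsub>R\<^esub> b) (s \<otimes>\<^bsub>R\<^esub> t)),
      one = fraction R S \<one>\<^bsub>R\<^esub> \<one>\<^bsub>R\<^esub>,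
      zero = fraction R S \<zero>\<^bsub>R\<^esub> \<one>\<^bsub>R\<^esub>,
      add = (\<lambda>x y. \<Union>(a, s)\<in>x. \<Union>(b, t)\<in>y.
               fraction R S (a \<otimes>\<^bsub>R\<^esub> t \<oplus>\<^bsub>R\<^esub> b \<otimes>\<^bsub>R\<^esub> s) (s \<otimes>\<^bsub>R\<^esub> t))\<rparr>"

text \<open>\<open>J R\<^sub>P \<inter> R\<close>: extend \<open>J\<close> to the localization at the prime \<open>P\<close>, then pull back along
  \<open>r \<mapsto> r/1\<close>.\<close>

definition local_contraction :: "('a, 'b) ring_scheme \<Rightarrow> 'a set \<Rightarrow> 'a set \<Rightarrow> 'a set" where
  "local_contraction R P J =
     (let S = carrier R - P; \<iota> = (\<lambda>r. fraction R S r \<one>\<^bsub>R\<^esub>)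
      in {r \<in> carrier R. \<iota> r \<in> Idl\<^bsub>localization R S\<^esub> (\<iota> ` J)})"


section \<open>Associated and minimal primes, symbolic powers\<close>

definition associated_primes ::
    "('a, 'b) ring_scheme \<Rightarrow> ('a, 'c, 'd) module_scheme \<Rightarrow> 'a set set" where
  "associated_primes R M =
     {P. primeideal P R \<and>
         (\<exists>x\<in>carrier M. P = {r \<in> carrier R. r \<odot>\<^bsub>M\<^esub> x = \<zero>\<^bsub>M\<^esub>})}"

definition quotient_module :: "('a, 'b) ring_scheme \<Rightarrow> 'a set \<Rightarrow> ('a, 'a set) module" where
  "quotient_module R J =
     ring.extend (R Quot J)
       (module.fields (\<lambda>r x. (J +>\<^bsub>R\<^esub> r) \<otimes>\<^bsub>R Quot J\<^esub> x))"

definition Ass :: "('a, 'b) ring_scheme \<Rightarrow> 'a set \<Rightarrow> 'a set set" where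
  "Ass R J = associated_primes R (quotient_module R J)"

definition minimal_primes :: "('a, 'b) ring_scheme \<Rightarrow> 'a set \<Rightarrow> 'a set set" where
  "minimal_primes R J =
     {P. primeideal P R \<and> J \<subseteq> P \<and> (\<forall>Q. primeideal Q R \<and> J \<subseteq> Q \<and> Q \<subseteq> P \<longrightarrow> Q = P)}"

text \<open>The two conventions in use for symbolic powers.\<close>

datatype symbolic_convention = By_Ass | By_Min

primrec symbolic_primes ::
    "('a, 'b) ring_scheme \<Rightarrow> symbolic_convention \<Rightarrow> 'a set \<Rightarrow> 'a set set" where
  "symbolic_primes R By_Ass I = Ass R I"
| "symbolic_primes R By_Min I = minimal_primes R I"

definition symbolic_power ::
    "('a, 'b) ring_scheme \<Rightarrow> symbolic_convention \<Rightarrow> 'a set \<Rightarrow> nat \<Rightarrow> 'a set" where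
  "symbolic_power R conv I k =
     (if k = 0 then carrier R
      else carrier R \<inter>
        (\<Inter>P\<in>symbolic_primes R conv I. local_contraction R P (I [^]\<^bsub>ideals_set R\<^esub> k)))"

definition colon :: "('a, 'b) ring_scheme \<Rightarrow> 'a set \<Rightarrow> 'a set \<Rightarrow> 'a set" where
  "colon R J K = {r \<in> carrier R. \<forall>x\<in>K. r \<otimes>\<^bsub>R\<^esub> x \<in> J}"

definition symbolic_strong_persistence ::
    "('a, 'b) ring_scheme \<Rightarrow> symbolic_convention \<Rightarrow> 'a set \<Rightarrow> bool" where
  "symbolic_strong_persistence R conv I \<longleftrightarrow>
     (\<forall>k\<ge>1. colon R (symbolic_power R conv I k) (symbolic_power R conv I 1) =
             symbolic_power R conv I (k - 1))"


section \<open>Generator degrees and the v-number\<close>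

definition minimal_homogeneous_generators ::
    "('a, 'b) ring_scheme \<Rightarrow> (nat \<Rightarrow> 'a set) \<Rightarrow> 'a set \<Rightarrow> 'a set \<Rightarrow> bool" where
  "minimal_homogeneous_generators R A J G \<longleftrightarrow>
     G \<subseteq> (\<Union>d. A d) \<and> Idl\<^bsub>R\<^esub> G = J \<and> (\<forall>H. H \<subset> G \<longrightarrow> Idl\<^bsub>R\<^esub> H \<noteq> J)"

text \<open>For a nonzero graded ideal \<open>J\<close> of a Noetherian graded ring the value is the same for every
  minimal homogeneous generating set \<open>G\<close>: by the graded Nakayama lemma it is the largest degree in
  which \<open>J / R\<^sub>+J\<close> is nonzero. Minimality excludes \<open>0 \<in> G\<close>, so each \<open>g \<in> G\<close> lies in exactly one
  \<open>A d\<close>. The value is unspecified for \<open>J = 0\<close>, where no maximum exists.\<close>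

definition max_gen_degree ::
    "('a, 'b) ring_scheme \<Rightarrow> (nat \<Rightarrow> 'a set) \<Rightarrow> 'a set \<Rightarrow> nat" where
  "max_gen_degree R A J =
     Max {d. \<exists>g \<in> (SOME G. minimal_homogeneous_generators R A J G). g \<in> A d}"

text \<open>For a proper graded ideal \<open>J\<close> of a Noetherian graded ring such a \<open>d\<close> exists.\<close>

definition v_number :: "('a, 'b) ring_scheme \<Rightarrow> (nat \<Rightarrow> 'a set) \<Rightarrow> 'a set \<Rightarrow> nat" where
  "v_number R A J = (LEAST d. \<exists>f\<in>A d. \<exists>P\<in>Ass R J. colon R J {f} = P)"

end

theory Submission
  imports Defs
begin

text \<open>Write \<open>J\<^sub>k\<close> for the \<open>k\<close>-th symbolic power and \<open>G\<close> for a finite set of homogeneous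
  generators of \<open>J\<^sub>1\<close>. If \<open>f\<close> is homogeneous and \<open>(J\<^sub>k : f)\<close> is a prime \<open>P\<close>, then by persistence
  \<open>P = ((J\<^sub>k\<^sub>+\<^sub>1 : J\<^sub>1) : f)\<close> is the intersection of the ideals \<open>(J\<^sub>k\<^sub>+\<^sub>1 : g f)\<close> for \<open>g \<in> G\<close>, and a prime
  that is a finite intersection of ideals equals one of them. So passing from \<open>k\<close> to \<open>k + 1\<close> costs
  at most the degree of some \<open>g\<close>.

  The induction starts because \<open>J\<^sub>1\<close> is a graded ideal: contracting a graded ideal from the
  localization at any prime, graded or not, gives a graded ideal. If \<open>J\<^sub>1\<close> is proper, a maximal
  \<open>(J\<^sub>1 : f)\<close> with \<open>f\<close> homogeneous and not in \<open>J\<^sub>1\<close> is prime. If \<open>J\<^sub>1 = R\<close>, then persistence forces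
  \<open>J\<^sub>k = R\<close> for all \<open>k\<close> and both \<open>v\<close>-numbers are the same unspecified value.\<close>

section \<open>Localization of a domain\<close>

locale multiplicative_subset = domain R for R (structure) +
  fixes S
  assumes S_carrier: "S \<subseteq> carrier R"
    and one_S: "\<one> \<in> S"
    and mult_S: "\<lbrakk>s \<in> S; t \<in> S\<rbrakk> \<Longrightarrow> s \<otimes> t \<in> S"
    and zero_S: "\<zero> \<notin> S"
begin

abbreviation frac :: "'a \<Rightarrow> 'a \<Rightarrow> ('a \<times> 'a) set" where
  "frac a s \<equiv> fraction R S a s"

lemma S_closed [simp]: "s \<in> S \<Longrightarrow> s \<in> carrier R"
  using S_carrier by blast

text \<open>A factor \<open>u\<close> from \<open>S\<close> is nonzero, and in a domain it can be
  cancelled from \<open>u (a t - b s) = 0\<close>.\<close>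

lemma fraction_rel_iff:
  "((a, s), (b, t)) \<in> fraction_rel R S \<longleftrightarrow>
     a \<in> carrier R \<and> b \<in> carrier R \<and> s \<in> S \<and> t \<in> S \<and> a \<otimes> t = b \<otimes> s"
proof -
  have "(\<exists>u\<in>S. u \<otimes> (a \<otimes> t \<ominus> b \<otimes> s) = \<zero>) \<longleftrightarrow> a \<otimes> t = b \<otimes> s"
    if "a \<in> carrier R" "b \<in> carrier R" "s \<in> S" "t \<in> S"
  proof
    assume "\<exists>u\<in>S. u \<otimes> (a \<otimes> t \<ominus> b \<otimes> s) = \<zero>"
    then obtain u where u: "u \<in> S" "u \<otimes> (a \<otimes> t \<ominus> b \<otimes> s) = \<zero>" by blast
    then have "u = \<zero> \<or> a \<otimes> t \<ominus> b \<otimes> s = \<zero>" using that by (intro integral) auto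
    then show "a \<otimes> t = b \<otimes> s" using u(1) zero_S that by auto
  next
    assume "a \<otimes> t = b \<otimes> s"
    then have "\<one> \<otimes> (a \<otimes> t \<ominus> b \<otimes> s) = \<zero>" using that by simp
    then show "\<exists>u\<in>S. u \<otimes> (a \<otimes> t \<ominus> b \<otimes> s) = \<zero>" using one_S by blast
  qed
  then show ?thesis by (auto simp: fraction_rel_def)
qed

text \<open>The two sides agree after multiplication by the middle denominator \<open>t\<close>,
  which is nonzero and cancels.\<close>

lemma cross_trans:
  assumes "a \<in> carrier R" "b \<in> carrier R" "c \<in> carrier R" "s \<in> S" "t \<in> S" "u \<in> S"
    and "a \<otimes> t = b \<otimes> s" "b \<otimes> u = c \<otimes> t"
  shows "a \<otimes> u = c \<otimes> s"
proof -
  have "t \<otimes> (a \<otimes> u) = (a \<otimes> t) \<otimes> u" using assms(1-6) by (simp add: m_ac)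
  also have "\<dots> = (b \<otimes> u) \<otimes> s" using assms(1-7) by (simp add: m_ac)
  also have "\<dots> = t \<otimes> (c \<otimes> s)" using assms(1-6,8) by (simp add: m_ac)
  finally show ?thesis using assms(1-6) zero_S m_lcancel[of t "a \<otimes> u" "c \<otimes> s"] by auto
qed

lemma equiv_fraction_rel: "equiv (carrier R \<times> S) (fraction_rel R S)"
proof (rule equivI)
  show "fraction_rel R S \<subseteq> (carrier R \<times> S) \<times> (carrier R \<times> S)"
    by (auto simp: fraction_rel_def)
  show "refl_on (carrier R \<times> S) (fraction_rel R S)"
    by (auto simp: refl_on_def fraction_rel_iff)
  show "sym (fraction_rel R S)"
    by (auto simp: sym_def fraction_rel_iff)
  show "trans (fraction_rel R S)"
    unfolding trans_def by (auto simp: fraction_rel_iff intro: cross_trans)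
qed

lemma fraction_eq_iff:
  assumes "a \<in> carrier R" "s \<in> S" "b \<in> carrier R" "t \<in> S"
  shows "frac a s = frac b t \<longleftrightarrow> a \<otimes> t = b \<otimes> s"
  using eq_equiv_class_iff[OF equiv_fraction_rel, of "(a, s)" "(b, t)"] assms
  by (simp add: fraction_def fraction_rel_iff)

lemma localization_carrier:
  "carrier (localization R S) = {frac a s | a s. a \<in> carrier R \<and> s \<in> S}"
  by (auto simp: localization_def quotient_def fraction_def)

lemma localization_cases:
  assumes "x \<in> carrier (localization R S)"
  obtains a s where "a \<in> carrier R" "s \<in> S" "x = frac a s"
  using assms by (auto simp: localization_carrier)

lemma frac_closed: "\<lbrakk>a \<in> carrier R; s \<in> S\<rbrakk> \<Longrightarrow> frac a s \<in> carrier (localization R S)"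
  by (auto simp: localization_carrier)

text \<open>Congruence on representatives collapses the two unions in the definition to a single
  fraction; sums are treated in the same way.\<close>

lemma frac_mult:
  assumes "a \<in> carrier R" "s \<in> S" "b \<in> carrier R" "t \<in> S"
  shows "frac a s \<otimes>\<^bsub>localization R S\<^esub> frac b t = frac (a \<otimes> b) (s \<otimes> t)"
proof -
  let ?f = "\<lambda>(a, s) (b, t). frac (a \<otimes> b) (s \<otimes> t)"
  have "congruent2 (fraction_rel R S) (fraction_rel R S) ?f"
  proof (rule congruent2I')
    fix x x' y y' assume xy: "(x, x') \<in> fraction_rel R S" "(y, y') \<in> fraction_rel R S"
    obtain a s a' s' b t b' t' where [simp]: "x = (a, s)" "x' = (a', s')" "y = (b, t)" "y' = (b', t')"
      by (metis surj_pair)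
    have c: "a \<in> carrier R" "a' \<in> carrier R" "b \<in> carrier R" "b' \<in> carrier R"
      "s \<in> S" "s' \<in> S" "t \<in> S" "t' \<in> S" and e: "a \<otimes> s' = a' \<otimes> s" "b \<otimes> t' = b' \<otimes> t"
      using xy by (auto simp: fraction_rel_iff)
    have "(a \<otimes> b) \<otimes> (s' \<otimes> t') = (a \<otimes> s') \<otimes> (b \<otimes> t')" using c by (simp add: m_ac)
    also have "\<dots> = (a' \<otimes> b') \<otimes> (s \<otimes> t)" unfolding e using c by (simp add: m_ac)
    finally show "?f x y = ?f x' y'" using c by (simp add: fraction_eq_iff mult_S)
  qed
  from UN_equiv_class2[OF equiv_fraction_rel equiv_fraction_rel this, of "(a, s)" "(b, t)"]
  show ?thesis using assms
    by (simp add: localization_def fraction_def case_prod_unfold)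
qed

lemma frac_add:
  assumes "a \<in> carrier R" "s \<in> S" "b \<in> carrier R" "t \<in> S"
  shows "frac a s \<oplus>\<^bsub>localization R S\<^esub> frac b t = frac (a \<otimes> t \<oplus> b \<otimes> s) (s \<otimes> t)"
proof -
  let ?f = "\<lambda>(a, s) (b, t). frac (a \<otimes> t \<oplus> b \<otimes> s) (s \<otimes> t)"
  have "congruent2 (fraction_rel R S) (fraction_rel R S) ?f"
  proof (rule congruent2I')
    fix x x' y y' assume xy: "(x, x') \<in> fraction_rel R S" "(y, y') \<in> fraction_rel R S"
    obtain a s a' s' b t b' t' where [simp]: "x = (a, s)" "x' = (a', s')" "y = (b, t)" "y' = (b', t')"
      by (metis surj_pair)
    have c: "a \<in> carrier R" "a' \<in> carrier R" "b \<in> carrier R" "b' \<in> carrier R"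
      "s \<in> S" "s' \<in> S" "t \<in> S" "t' \<in> S" and e: "a \<otimes> s' = a' \<otimes> s" "b \<otimes> t' = b' \<otimes> t"
      using xy by (auto simp: fraction_rel_iff)
    have "(a \<otimes> t \<oplus> b \<otimes> s) \<otimes> (s' \<otimes> t') = (a \<otimes> s') \<otimes> (t \<otimes> t') \<oplus> (b \<otimes> t') \<otimes> (s \<otimes> s')"
      using c by (simp add: m_ac l_distr r_distr)
    also have "\<dots> = (a' \<otimes> t' \<oplus> b' \<otimes> s') \<otimes> (s \<otimes> t)"
      unfolding e using c by (simp add: m_ac l_distr r_distr)
    finally show "?f x y = ?f x' y'" using c by (simp add: fraction_eq_iff mult_S)
  qed
  from UN_equiv_class2[OF equiv_fraction_rel equiv_fraction_rel this, of "(a, s)" "(b, t)"]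
  show ?thesis using assms
    by (simp add: localization_def fraction_def case_prod_unfold)
qed

lemma localization_one: "\<one>\<^bsub>localization R S\<^esub> = frac \<one> \<one>"
  and localization_zero: "\<zero>\<^bsub>localization R S\<^esub> = frac \<zero> \<one>"
  by (simp_all add: localization_def)

lemmas localization_simps =
  localization_one localization_zero frac_mult frac_add frac_closed fraction_eq_iff
  mult_S one_S

lemma localization_cring: "cring (localization R S)"
proof (rule cringI)
  show "abelian_group (localization R S)"
  proof (rule abelian_groupI)
    fix x assume "x \<in> carrier (localization R S)"
    then obtain a s where x: "a \<in> carrier R" "s \<in> S" "x = frac a s" by (rule localization_cases)
    then show "\<zero>\<^bsub>localization R S\<^esub> \<oplus>\<^bsub>localization R S\<^esub> x = x"
      by (simp add: localization_simps)
    have "\<ominus> a \<otimes> s \<oplus> a \<otimes> s = \<zero>" using x by (simp add: l_minus l_neg)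
    then have "frac (\<ominus> a) s \<oplus>\<^bsub>localization R S\<^esub> x = \<zero>\<^bsub>localization R S\<^esub>"
      using x by (simp add: localization_simps)
    then show "\<exists>y\<in>carrier (localization R S). y \<oplus>\<^bsub>localization R S\<^esub> x = \<zero>\<^bsub>localization R S\<^esub>"
      using x frac_closed by blast
  next
    fix x y assume "x \<in> carrier (localization R S)" "y \<in> carrier (localization R S)"
    then obtain a s b t where x: "a \<in> carrier R" "s \<in> S" "x = frac a s"
      and y: "b \<in> carrier R" "t \<in> S" "y = frac b t" by (metis localization_cases)
    then show "x \<oplus>\<^bsub>localization R S\<^esub> y \<in> carrier (localization R S)"
      by (simp add: localization_simps)
    from x y show "x \<oplus>\<^bsub>localization R S\<^esub> y = y \<oplus>\<^bsub>localization R S\<^esub> x"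
      by (simp add: localization_simps m_ac a_ac)
  next
    fix x y z assume "x \<in> carrier (localization R S)" "y \<in> carrier (localization R S)"
      "z \<in> carrier (localization R S)"
    then obtain a s b t c u where x: "a \<in> carrier R" "s \<in> S" "x = frac a s"
      and y: "b \<in> carrier R" "t \<in> S" "y = frac b t"
      and z: "c \<in> carrier R" "u \<in> S" "z = frac c u" by (metis localization_cases)
    then show "x \<oplus>\<^bsub>localization R S\<^esub> y \<oplus>\<^bsub>localization R S\<^esub> z =
        x \<oplus>\<^bsub>localization R S\<^esub> (y \<oplus>\<^bsub>localization R S\<^esub> z)"
      by (simp add: localization_simps l_distr r_distr m_ac a_ac)
  next
    show "\<zero>\<^bsub>localization R S\<^esub> \<in> carrier (localization R S)"
      by (simp add: localization_simps)
  qed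
  show "comm_monoid (localization R S)"
  proof (rule comm_monoidI)
    show "\<one>\<^bsub>localization R S\<^esub> \<in> carrier (localization R S)"
      by (simp add: localization_simps)
  next
    fix x assume "x \<in> carrier (localization R S)"
    then obtain a s where x: "a \<in> carrier R" "s \<in> S" "x = frac a s" by (rule localization_cases)
    then show "\<one>\<^bsub>localization R S\<^esub> \<otimes>\<^bsub>localization R S\<^esub> x = x"
      by (simp add: localization_simps)
  next
    fix x y assume "x \<in> carrier (localization R S)" "y \<in> carrier (localization R S)"
    then obtain a s b t where x: "a \<in> carrier R" "s \<in> S" "x = frac a s"
      and y: "b \<in> carrier R" "t \<in> S" "y = frac b t" by (metis localization_cases)
    then show "x \<otimes>\<^bsub>localization R S\<^esub> y \<in> carrier (localization R S)"
      by (simp add: localization_simps)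
    from x y show "x \<otimes>\<^bsub>localization R S\<^esub> y = y \<otimes>\<^bsub>localization R S\<^esub> x"
      by (simp add: localization_simps m_ac)
  next
    fix x y z assume "x \<in> carrier (localization R S)" "y \<in> carrier (localization R S)"
      "z \<in> carrier (localization R S)"
    then obtain a s b t c u where x: "a \<in> carrier R" "s \<in> S" "x = frac a s"
      and y: "b \<in> carrier R" "t \<in> S" "y = frac b t"
      and z: "c \<in> carrier R" "u \<in> S" "z = frac c u" by (metis localization_cases)
    then show "x \<otimes>\<^bsub>localization R S\<^esub> y \<otimes>\<^bsub>localization R S\<^esub> z =
        x \<otimes>\<^bsub>localization R S\<^esub> (y \<otimes>\<^bsub>localization R S\<^esub> z)"
      by (simp add: localization_simps m_ac)
  qed
next
  fix x y z assume "x \<in> carrier (localization R S)" "y \<in> carrier (localization R S)"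
    "z \<in> carrier (localization R S)"
  then obtain a s b t c u where x: "a \<in> carrier R" "s \<in> S" "x = frac a s"
    and y: "b \<in> carrier R" "t \<in> S" "y = frac b t"
    and z: "c \<in> carrier R" "u \<in> S" "z = frac c u" by (metis localization_cases)
  then show "(x \<oplus>\<^bsub>localization R S\<^esub> y) \<otimes>\<^bsub>localization R S\<^esub> z =
      x \<otimes>\<^bsub>localization R S\<^esub> z \<oplus>\<^bsub>localization R S\<^esub> y \<otimes>\<^bsub>localization R S\<^esub> z"
    by (simp add: localization_simps l_distr r_distr m_ac)
qed

text \<open>Sums stay in the set by passing to a common denominator. This explicit form of the
  extension of \<open>J\<close> serves as an upper bound for the generated ideal.\<close>

lemma extended_ideal:
  assumes "ideal J R"
  shows "ideal {frac a s | a s. a \<in> J \<and> s \<in> S} (localization R S)" (is "ideal ?K _")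
proof -
  interpret J: ideal J R by fact
  interpret L: cring "localization R S" by (rule localization_cring)
  note [simp] = J.Icarr
  have mult: "x \<otimes>\<^bsub>localization R S\<^esub> k \<in> ?K"
    if "k \<in> ?K" "x \<in> carrier (localization R S)" for k x
  proof -
    obtain b t where k: "b \<in> J" "t \<in> S" "k = frac b t" using \<open>k \<in> ?K\<close> by blast
    obtain a s where x: "a \<in> carrier R" "s \<in> S" "x = frac a s"
      using \<open>x \<in> carrier (localization R S)\<close> by (rule localization_cases)
    have "x \<otimes>\<^bsub>localization R S\<^esub> k = frac (a \<otimes> b) (s \<otimes> t)" using k x by (simp add: frac_mult)
    then show ?thesis using k x J.I_l_closed mult_S by blast
  qed
  have sub: "?K \<subseteq> carrier (localization R S)" by (auto intro: frac_closed)
  show ?thesis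
  proof (rule idealI)
    show "ring (localization R S)" by (rule L.ring_axioms)
    show "subgroup ?K (add_monoid (localization R S))"
    proof (rule L.add.subgroupI)
      show "?K \<subseteq> carrier (localization R S)" by (rule sub)
      show "?K \<noteq> {}" using J.zero_closed one_S by blast
    next
      fix x assume "x \<in> ?K"
      then have "(\<ominus>\<^bsub>localization R S\<^esub> \<one>\<^bsub>localization R S\<^esub>) \<otimes>\<^bsub>localization R S\<^esub> x \<in> ?K"
        by (intro mult) auto
      then show "\<ominus>\<^bsub>localization R S\<^esub> x \<in> ?K"
        using \<open>x \<in> ?K\<close> sub by (simp add: L.l_minus subset_iff)
    next
      fix x y assume "x \<in> ?K" "y \<in> ?K"
      then obtain a s b t where x: "a \<in> J" "s \<in> S" "x = frac a s"
        and y: "b \<in> J" "t \<in> S" "y = frac b t" by blast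
      then have "x \<oplus>\<^bsub>localization R S\<^esub> y = frac (a \<otimes> t \<oplus> b \<otimes> s) (s \<otimes> t)"
        by (simp add: frac_add)
      moreover have "a \<otimes> t \<oplus> b \<otimes> s \<in> J" using x y by (simp add: J.I_r_closed)
      ultimately show "x \<oplus>\<^bsub>localization R S\<^esub> y \<in> ?K" using x y mult_S by blast
    qed
  next
    fix k x assume k: "k \<in> ?K" and x: "x \<in> carrier (localization R S)"
    show kx: "x \<otimes>\<^bsub>localization R S\<^esub> k \<in> ?K" by (rule mult[OF k x])
    have "k \<otimes>\<^bsub>localization R S\<^esub> x = x \<otimes>\<^bsub>localization R S\<^esub> k"
      by (rule L.m_comm[OF subsetD[OF sub k] x])
    then show "k \<otimes>\<^bsub>localization R S\<^esub> x \<in> ?K" by (rule ssubst) (rule kx)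
  qed
qed

text \<open>The generators \<open>a/1\<close> lie in the explicit extension, so
  \<open>r/1 = a/s\<close> with \<open>a\<close> in \<open>J\<close>, which clears to
  \<open>s r = a\<close>. Conversely, \<open>r/1\<close> is \<open>1/s\<close> times
  \<open>(s r)/1\<close>.\<close>

lemma frac_mem_extended_ideal_iff:
  assumes "ideal J R" "r \<in> carrier R"
  shows "frac r \<one> \<in> Idl\<^bsub>localization R S\<^esub> ((\<lambda>a. frac a \<one>) ` J) \<longleftrightarrow> (\<exists>s\<in>S. s \<otimes> r \<in> J)"
proof -
  interpret J: ideal J R by fact
  interpret L: cring "localization R S" by (rule localization_cring)
  note [simp] = J.Icarr
  show ?thesis
  proof
    have "Idl\<^bsub>localization R S\<^esub> ((\<lambda>a. frac a \<one>) ` J) \<subseteq> {frac a s | a s. a \<in> J \<and> s \<in> S}"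
      using one_S by (intro L.genideal_minimal extended_ideal assms(1)) blast
    moreover assume "frac r \<one> \<in> Idl\<^bsub>localization R S\<^esub> ((\<lambda>a. frac a \<one>) ` J)"
    ultimately obtain a s where "a \<in> J" "s \<in> S" "frac r \<one> = frac a s" by blast
    then show "\<exists>s\<in>S. s \<otimes> r \<in> J"
      using assms(2) one_S by (auto simp: fraction_eq_iff m_comm[of r])
  next
    assume "\<exists>s\<in>S. s \<otimes> r \<in> J"
    then obtain s where s: "s \<in> S" "s \<otimes> r \<in> J" by blast
    have "(\<lambda>a. frac a \<one>) ` J \<subseteq> carrier (localization R S)"
      by (auto simp: frac_closed one_S)
    then interpret E: ideal "Idl\<^bsub>localization R S\<^esub> ((\<lambda>a. frac a \<one>) ` J)" "localization R S"
      by (rule L.genideal_ideal)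
    have "frac (s \<otimes> r) \<one> \<in> Idl\<^bsub>localization R S\<^esub> ((\<lambda>a. frac a \<one>) ` J)"
      using s(2) by (auto simp: genideal_def)
    then have "frac \<one> s \<otimes>\<^bsub>localization R S\<^esub> frac (s \<otimes> r) \<one>
        \<in> Idl\<^bsub>localization R S\<^esub> ((\<lambda>a. frac a \<one>) ` J)"
      using s(1) by (intro E.I_l_closed) (auto simp: frac_closed)
    moreover have "frac \<one> s \<otimes>\<^bsub>localization R S\<^esub> frac (s \<otimes> r) \<one> = frac r \<one>"
      using s(1) assms(2) by (simp add: localization_simps m_comm)
    ultimately show "frac r \<one> \<in> Idl\<^bsub>localization R S\<^esub> ((\<lambda>a. frac a \<one>) ` J)" by simp
  qed
qed

end

section \<open>Contraction from a localization as a saturation\<close>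

lemma (in primeideal) one_notin: "\<one> \<notin> I"
  using I_notcarr one_imp_carrier by metis

text \<open>This is the contraction \<open>J R_P \<inter> R\<close> with the fractions cleared;
  later arguments on symbolic powers stay inside \<open>R\<close> by means of it.\<close>

definition saturation :: "('a, 'b) ring_scheme \<Rightarrow> 'a set \<Rightarrow> 'a set \<Rightarrow> 'a set" where
  "saturation R P J = {r \<in> carrier R. \<exists>s\<in>carrier R - P. s \<otimes>\<^bsub>R\<^esub> r \<in> J}"

lemma (in domain) local_contraction_eq_saturation:
  assumes "primeideal P R" "ideal J R"
  shows "local_contraction R P J = saturation R P J"
proof -
  interpret P: primeideal P R by fact
  interpret multiplicative_subset R "carrier R - P"
    by unfold_locales (use P.one_notin P.I_prime P.zero_closed in auto)
  show ?thesis
    using frac_mem_extended_ideal_iff[OF assms(2)]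
    by (auto simp: local_contraction_def saturation_def Let_def)
qed

section \<open>Colon ideals and symbolic powers\<close>

lemma (in ring) idealI':
  assumes "J \<subseteq> carrier R" "\<zero> \<in> J"
    and "\<And>x y. \<lbrakk>x \<in> J; y \<in> J\<rbrakk> \<Longrightarrow> x \<oplus> y \<in> J"
    and "\<And>r x. \<lbrakk>r \<in> carrier R; x \<in> J\<rbrakk> \<Longrightarrow> r \<otimes> x \<in> J"
    and "\<And>r x. \<lbrakk>r \<in> carrier R; x \<in> J\<rbrakk> \<Longrightarrow> x \<otimes> r \<in> J"
  shows "ideal J R"
proof (rule idealI)
  show "subgroup J (add_monoid R)"
  proof (rule add.subgroupI)
    fix x assume "x \<in> J"
    \<comment> \<open>Closure under negation comes from multiplication by
      \<open>\<ominus> \<one>\<close>.\<close>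
    then have "\<ominus> \<one> \<otimes> x \<in> J" using assms(4) by simp
    then show "\<ominus> x \<in> J" using \<open>x \<in> J\<close> assms(1) by (simp add: l_minus subset_iff)
  qed (use assms in auto)
qed (use assms ring_axioms in auto)

context cring
begin

lemma saturation_ideal:
  assumes "primeideal P R" "ideal J R"
  shows "ideal (saturation R P J) R"
proof -
  interpret P: primeideal P R by fact
  interpret J: ideal J R by fact
  have mult: "r \<otimes> x \<in> saturation R P J" if r: "r \<in> carrier R" and x: "x \<in> saturation R P J" for r x
  proof -
    obtain s where s: "s \<in> carrier R - P" "s \<otimes> x \<in> J" "x \<in> carrier R"
      using x by (auto simp: saturation_def)
    then have "s \<otimes> (r \<otimes> x) \<in> J" using J.I_l_closed[of "s \<otimes> x" r] r by (simp add: m_ac)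
    then show ?thesis using s r unfolding saturation_def by auto
  qed
  show ?thesis
  proof (rule idealI')
    show "saturation R P J \<subseteq> carrier R" by (auto simp: saturation_def)
    show "\<zero> \<in> saturation R P J"
      using P.one_notin by (auto simp: saturation_def intro!: bexI[of _ \<one>])
  next
    fix x y assume "x \<in> saturation R P J" "y \<in> saturation R P J"
    then obtain s t where s: "s \<in> carrier R - P" "s \<otimes> x \<in> J" "x \<in> carrier R"
      and t: "t \<in> carrier R - P" "t \<otimes> y \<in> J" "y \<in> carrier R"
      by (auto simp: saturation_def)
    \<comment> \<open>The product \<open>s t\<close> multiplies both summands into \<open>J\<close>,
      and it stays outside \<open>P\<close> because \<open>P\<close> is prime.\<close>
    have "(s \<otimes> t) \<otimes> (x \<oplus> y) = t \<otimes> (s \<otimes> x) \<oplus> s \<otimes> (t \<otimes> y)"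
      using s t by (simp add: r_distr m_ac)
    also have "\<dots> \<in> J" using s t by (simp add: J.I_l_closed)
    finally have "(s \<otimes> t) \<otimes> (x \<oplus> y) \<in> J" .
    moreover have "s \<otimes> t \<in> carrier R - P" using s t P.I_prime by auto
    ultimately show "x \<oplus> y \<in> saturation R P J" using s t unfolding saturation_def by blast
  next
    fix r x assume rx: "r \<in> carrier R" "x \<in> saturation R P J"
    then show "r \<otimes> x \<in> saturation R P J" by (rule mult)
    then show "x \<otimes> r \<in> saturation R P J"
      using rx m_comm[of r x] by (auto simp: saturation_def)
  qed
qed

lemma colon_ideal:
  assumes "ideal J R" "K \<subseteq> carrier R"
  shows "ideal (colon R J K) R"
proof -
  interpret J: ideal J R by fact
  show ?thesis
  proof (rule idealI')
    fix r x assume "r \<in> carrier R" "x \<in> colon R J K"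
    then show "r \<otimes> x \<in> colon R J K" "x \<otimes> r \<in> colon R J K"
      using assms(2) J.I_l_closed by (auto simp: colon_def m_assoc m_comm[of x r] subset_iff)
  qed (use assms(2) in \<open>auto simp: colon_def l_distr subset_iff\<close>)
qed

text \<open>For fixed \<open>r\<close> the elements \<open>x\<close> with \<open>r x\<close> in
  \<open>J\<close> form an ideal, so it is enough that they include the generators.\<close>

lemma colon_Idl:
  assumes "ideal J R" "G \<subseteq> carrier R"
  shows "colon R J (Idl G) = colon R J G"
proof
  show "colon R J (Idl G) \<subseteq> colon R J G"
    using genideal_self[OF assms(2)] by (auto simp: colon_def)
  show "colon R J G \<subseteq> colon R J (Idl G)"
  proof
    fix r assume r: "r \<in> colon R J G"
    then have "r \<in> carrier R" by (simp add: colon_def)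
    then have "Idl G \<subseteq> colon R J {r}"
      using r assms by (intro genideal_minimal colon_ideal) (auto simp: colon_def m_comm subset_iff)
    then show "r \<in> colon R J (Idl G)"
      using \<open>r \<in> carrier R\<close> by (auto simp: colon_def m_comm subset_iff)
  qed
qed

lemma colon_eq_carrier_iff:
  assumes "ideal J R" "K \<subseteq> carrier R"
  shows "colon R J K = carrier R \<longleftrightarrow> K \<subseteq> J"
proof
  assume "colon R J K = carrier R"
  then have "\<one> \<in> colon R J K" by simp
  then show "K \<subseteq> J" using assms(2) by (auto simp: colon_def subset_iff)
next
  interpret J: ideal J R by fact
  assume "K \<subseteq> J"
  then show "colon R J K = carrier R" using J.I_l_closed by (auto simp: colon_def)
qed

text \<open>Every element of \<open>R/J\<close> is a coset \<open>J + x\<close>, and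
  \<open>r\<close> annihilates it exactly when \<open>r x\<close> lies in \<open>J\<close>. This
  removes the quotient module from the later arguments.\<close>

lemma Ass_iff:
  assumes "ideal J R"
  shows "P \<in> Ass R J \<longleftrightarrow> primeideal P R \<and> (\<exists>x\<in>carrier R. P = colon R J {x})"
proof -
  interpret J: ideal J R by fact
  have ann: "{r \<in> carrier R. (J +> r) \<otimes>\<^bsub>R Quot J\<^esub> (J +> x) = J} = colon R J {x}"
    if x: "x \<in> carrier R" for x
  proof -
    have "(J +> r) \<otimes>\<^bsub>R Quot J\<^esub> (J +> x) = J \<longleftrightarrow> r \<otimes> x \<in> J" if "r \<in> carrier R" for r
      using J.rcos_const_imp_mem[of "r \<otimes> x"] a_rcos_zero[OF assms, of "r \<otimes> x"] that x
      by (auto simp: FactRing_def J.rcoset_mult_add)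
    then show ?thesis by (auto simp: colon_def)
  qed
  have "carrier (quotient_module R J) = (\<lambda>x. J +> x) ` carrier R"
    by (auto simp: quotient_module_def ring.defs module.defs FactRing_def A_RCOSETS_def')
  moreover have "\<zero>\<^bsub>quotient_module R J\<^esub> = J"
    and "r \<odot>\<^bsub>quotient_module R J\<^esub> x = (J +> r) \<otimes>\<^bsub>R Quot J\<^esub> x" for r x
    by (simp_all add: quotient_module_def ring.defs module.defs FactRing_def)
  ultimately show ?thesis
    using ann by (auto simp: Ass_def associated_primes_def)
qed

text \<open>A prime \<open>(J : f)\<close> is associated with \<open>f\<close> as its witness, so
  primality alone decides. The predicates under \<open>LEAST\<close> agree, hence the equation also
  covers the case where no degree satisfies them.\<close>

lemma v_number_eq:
  assumes "ideal J R" "\<And>d. A d \<subseteq> carrier R"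
  shows "v_number R A J = (LEAST d. \<exists>f\<in>A d. primeideal (colon R J {f}) R)"
proof -
  have "(\<exists>P\<in>Ass R J. colon R J {f} = P) \<longleftrightarrow> primeideal (colon R J {f}) R" if "f \<in> A d" for f d
    using Ass_iff[OF assms(1), of "colon R J {f}"] that assms(2) by blast
  then show ?thesis
    unfolding v_number_def by (intro arg_cong[where f = Least] ext bex_cong refl)
qed

text \<open>Otherwise every \<open>(J : g f)\<close> contains \<open>P\<close> properly. Elements
  chosen outside \<open>P\<close>, one from each, have a product in the intersection of these
  ideals, which is \<open>P\<close>, although primality keeps the product outside
  \<open>P\<close>.\<close>

lemma prime_eq_colon_generator:
  assumes "primeideal P R" "ideal J R" "finite G" "G \<subseteq> carrier R" "f \<in> carrier R"
    and P: "P = colon R (colon R J G) {f}"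
  shows "\<exists>g\<in>G. P = colon R J {g \<otimes> f}"
proof (rule ccontr)
  assume neq: "\<not> ?thesis"
  interpret P: primeideal P R by fact
  interpret J: ideal J R by fact
  have P_iff: "r \<in> P \<longleftrightarrow> (\<forall>g\<in>G. r \<in> colon R J {g \<otimes> f})" if "r \<in> carrier R" for r
    using that assms(4,5) unfolding P
    by (auto simp: colon_def m_ac subset_iff)
  have gen: "\<exists>r\<in>carrier R - P. \<forall>g\<in>G'. r \<in> colon R J {g \<otimes> f}" if "G' \<subseteq> G" for G'
    using finite_subset[OF that assms(3)] that
  proof (induction G' rule: finite_induct)
    case empty
    then show ?case using P.one_notin by auto
  next
    case (insert g G')
    then obtain r where r: "r \<in> carrier R - P" "\<forall>g\<in>G'. r \<in> colon R J {g \<otimes> f}" by blast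
    have g: "g \<in> carrier R" using insert.prems assms(4) by blast
    have "P \<subseteq> colon R J {g \<otimes> f}"
    proof
      fix r assume "r \<in> P"
      then show "r \<in> colon R J {g \<otimes> f}" using P_iff[OF P.Icarr] insert.prems by blast
    qed
    then obtain s where s: "s \<in> colon R J {g \<otimes> f}" "s \<notin> P" using neq insert.prems by blast
    then have s': "s \<in> carrier R" by (simp add: colon_def)
    have "\<forall>h\<in>insert g G'. s \<otimes> r \<in> colon R J {h \<otimes> f}"
    proof
      fix h assume h: "h \<in> insert g G'"
      then have "h \<otimes> f \<in> carrier R" using insert.prems assms(4,5) by auto
      then interpret C: ideal "colon R J {h \<otimes> f}" R using assms(2) by (intro colon_ideal) auto
      show "s \<otimes> r \<in> colon R J {h \<otimes> f}"
        using h r s s' C.I_l_closed C.I_r_closed by auto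
    qed
    moreover have "s \<otimes> r \<in> carrier R - P" using s s' r P.I_prime by auto
    ultimately show ?case by blast
  qed
  then obtain r where "r \<in> carrier R - P" "\<forall>g\<in>G. r \<in> colon R J {g \<otimes> f}" by blast
  then show False using P_iff by blast
qed

section \<open>Powers and symbolic powers are ideals\<close>

lemma ideal_power_ideal:
  assumes "ideal J R"
  shows "ideal (J [^]\<^bsub>ideals_set R\<^esub> (k::nat)) R"
proof -
  interpret M: comm_monoid "ideals_set R" by (rule ideals_set_is_comm_monoid)
  show ?thesis using M.nat_pow_closed[of J k] assms by (simp add: ideals_set_def)
qed

lemma ideal_power_1:
  assumes "ideal J R"
  shows "J [^]\<^bsub>ideals_set R\<^esub> (1::nat) = J"
proof -
  interpret M: comm_monoid "ideals_set R" by (rule ideals_set_is_comm_monoid)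
  show ?thesis using M.nat_pow_eone[of J] assms by (simp add: ideals_set_def)
qed

lemma symbolic_primes_prime: 
  assumes "P \<in> symbolic_primes R conv J"
  shows "primeideal P R"
  using assms by (cases conv) (auto simp: Ass_def associated_primes_def minimal_primes_def)

lemma carrier_Int_INT_ideal:
  assumes "\<And>P. P \<in> X \<Longrightarrow> ideal (F P) R"
  shows "ideal (carrier R \<inter> (\<Inter>P\<in>X. F P)) R"
proof -
  \<comment> \<open>With \<open>carrier R\<close> as a member the family is nonempty even for empty
    \<open>X\<close>, as \<open>i_Intersect\<close> requires.\<close>
  have "carrier R \<inter> (\<Inter>P\<in>X. F P) = \<Inter>(insert (carrier R) (F ` X))" by auto
  then show ?thesis using i_Intersect[of "insert (carrier R) (F ` X)"] assms oneideal by auto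
qed

end

context domain
begin

lemma symbolic_power_eq:
  assumes "ideal J R" "k \<ge> 1"
  shows "symbolic_power R conv J k = carrier R \<inter>
    (\<Inter>P\<in>symbolic_primes R conv J. saturation R P (J [^]\<^bsub>ideals_set R\<^esub> k))"
  using assms symbolic_primes_prime local_contraction_eq_saturation[OF _ ideal_power_ideal[OF assms(1)]]
  by (auto simp: symbolic_power_def)

lemma symbolic_power_ideal:
  assumes "ideal J R"
  shows "ideal (symbolic_power R conv J k) R"
proof (cases "k = 0")
  case False
  then show ?thesis
    by (simp add: symbolic_power_eq assms carrier_Int_INT_ideal saturation_ideal
        symbolic_primes_prime ideal_power_ideal)
qed (simp add: symbolic_power_def oneideal)

end

section \<open>Consequences of the Noetherian condition\<close>

context noetherian_ring
begin

text \<open>A nonempty chain of ideals in a Noetherian ring contains its own union, which is the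
  upper bound that Zorn's lemma asks for.\<close>

lemma exists_maximal_ideal_in:
  assumes "X \<noteq> {}" "\<And>J. J \<in> X \<Longrightarrow> ideal J R"
  shows "\<exists>M\<in>X. \<forall>J\<in>X. M \<subseteq> J \<longrightarrow> J = M"
proof (rule subset_Zorn)
  fix C assume C: "subset.chain X C"
  show "\<exists>U\<in>X. \<forall>J\<in>C. J \<subseteq> U"
  proof (cases "C = {}")
    case False
    have "subset.chain {J. ideal J R} C"
      using C assms(2) by (auto simp: subset.chain_def)
    then have "\<Union>C \<in> C" using False by (rule ideal_chain_is_trivial[rotated])
    then show ?thesis using C by (auto simp: subset.chain_def)
  qed (use assms(1) in auto)
qed

text \<open>Among the ideals generated by finite subsets of \<open>H\<close> take a maximal one;
  adjoining a further \<open>h\<close> cannot enlarge it. Because the generators come from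
  \<open>H\<close>, they are homogeneous when \<open>H\<close> is.\<close>

lemma finite_generating_subset:
  assumes "H \<subseteq> carrier R"
  shows "\<exists>G\<subseteq>H. finite G \<and> Idl G = Idl H"
proof -
  let ?X = "{Idl G | G. G \<subseteq> H \<and> finite G}"
  have "\<exists>M\<in>?X. \<forall>J\<in>?X. M \<subseteq> J \<longrightarrow> J = M"
    using assms by (intro exists_maximal_ideal_in) (auto intro!: genideal_ideal)
  then obtain M where M: "M \<in> ?X" and max: "\<forall>J\<in>?X. M \<subseteq> J \<longrightarrow> J = M" ..
  from M obtain G where G: "G \<subseteq> H" "finite G" and M_eq: "M = Idl G" by auto
  have "H \<subseteq> Idl G"
  proof
    fix h assume h: "h \<in> H"
    then have sub: "Idl G \<subseteq> Idl (insert h G)"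
      using G assms by (intro subset_Idl_subset) auto
    have "Idl (insert h G) \<in> ?X" using h G by auto
    from bspec[OF max this] sub have "Idl (insert h G) = Idl G" unfolding M_eq by (rule mp)
    moreover have "insert h G \<subseteq> Idl (insert h G)" using h G assms by (intro genideal_self) auto
    ultimately show "h \<in> Idl G" by simp
  qed
  then have "Idl H \<subseteq> Idl G" using G assms by (intro genideal_minimal genideal_ideal) auto
  moreover have "Idl G \<subseteq> Idl H" using G assms by (intro subset_Idl_subset) auto
  ultimately show ?thesis using G by blast
qed

end

section \<open>Graded ideals\<close>

locale graded_cring = cring R for R (structure) +
  fixes A :: "nat \<Rightarrow> 'a set"
  assumes graded: "graded_ring R A"
begin

lemma component_subgroup: "additive_subgroup (A d) R"
  using graded by (simp add: graded_ring_def)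

lemma component_carrier: "A d \<subseteq> carrier R"
  using component_subgroup by (rule additive_subgroup.a_subset)

lemma component_closed [simp]: "x \<in> A d \<Longrightarrow> x \<in> carrier R"
  using component_carrier by blast

lemma zero_component [simp]: "\<zero> \<in> A d"
  using component_subgroup by (rule additive_subgroup.zero_closed)

lemma mult_component: "\<lbrakk>x \<in> A i; y \<in> A j\<rbrakk> \<Longrightarrow> x \<otimes> y \<in> A (i + j)"
  using graded by (simp add: graded_ring_def)

lemma component_family_unique:
  assumes "component_family R A x c" "component_family R A x c'"
  shows "c = c'"
proof -
  have x: "x = (\<Oplus>d\<in>{d. c d \<noteq> \<zero>}. c d)" and c: "c d \<in> A d" for d
    using assms(1) by (auto simp: component_family_def)
  have "x \<in> carrier R" unfolding x using component_closed[OF c] by (intro finsum_closed) auto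
  then show ?thesis using graded assms by (auto simp: graded_ring_def)
qed

text \<open>The sum over the support is moved to a fixed range of degrees, to which a top component
  can be appended.\<close>

lemma component_family_bounded:
  assumes "\<And>d. c d \<in> A d" "\<And>d. d \<ge> n \<Longrightarrow> c d = \<zero>"
  shows "component_family R A (\<Oplus>d\<in>{..<n}. c d) c"
proof -
  have sub: "{d. c d \<noteq> \<zero>} \<subseteq> {..<n}" using assms(2) by (auto simp: not_le[symmetric])
  then have "(\<Oplus>d\<in>{d. c d \<noteq> \<zero>}. c d) = (\<Oplus>d\<in>{..<n}. c d)"
    using assms(1) by (intro add.finprod_mono_neutral_cong_left) (auto intro!: component_closed)
  then show ?thesis
    using assms(1) finite_subset[OF sub] by (auto simp: component_family_def)
qed

text \<open>The families with \<open>x\<close> placed in degree \<open>d\<close> only and in degree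
  \<open>e\<close> only both decompose \<open>x\<close>, so they coincide.\<close>

lemma degree_unique:
  assumes "x \<in> A d" "x \<in> A e" "x \<noteq> \<zero>"
  shows "d = e"
proof -
  have "component_family R A x (\<lambda>i. if i = d then x else \<zero>)" if "x \<in> A d" for d
  proof -
    have "{i. (if i = d then x else \<zero>) \<noteq> \<zero>} = {d}" using assms(3) by auto
    then show ?thesis using that by (simp add: component_family_def)
  qed
  from fun_cong[OF component_family_unique[OF this[OF assms(1)] this[OF assms(2)]], of d]
  show ?thesis using assms(3) by (simp split: if_splits)
qed

section \<open>Sums of consecutive components\<close>

text \<open>This is the sum of the \<open>w\<close> components of degrees \<open>k\<close> to
  \<open>k + w - 1\<close>. Such windows turn arguments on decompositions into inductions that peel
  off the top degree.\<close>

primrec segment :: "nat \<Rightarrow> nat \<Rightarrow> 'a set" where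
  "segment k 0 = {\<zero>}"
| "segment k (Suc w) = segment k w <+> A (k + w)"

lemma segment_subgroup: "additive_subgroup (segment k w) R"
proof (induction w)
  case 0
  then show ?case using zeroideal ideal.axioms(1) by auto
next
  case (Suc w)
  then show ?case using component_subgroup add_additive_subgroups by simp
qed

lemma segment_closed [simp]: "x \<in> segment k w \<Longrightarrow> x \<in> carrier R"
  using additive_subgroup.a_subset[OF segment_subgroup] by blast

lemma zero_segment [simp]: "\<zero> \<in> segment k w"
  using segment_subgroup by (rule additive_subgroup.zero_closed)

lemma add_segment: "\<lbrakk>x \<in> segment k w; y \<in> segment k w\<rbrakk> \<Longrightarrow> x \<oplus> y \<in> segment k w"
  using segment_subgroup by (rule additive_subgroup.a_closed)

lemma segment_SucI: "\<lbrakk>y \<in> segment k w; z \<in> A (k + w)\<rbrakk> \<Longrightarrow> y \<oplus> z \<in> segment k (Suc w)"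
  by (auto simp: set_add_defs)

lemma segment_SucE:
  assumes "x \<in> segment k (Suc w)"
  obtains y z where "y \<in> segment k w" "z \<in> A (k + w)" "x = y \<oplus> z"
  using assms by (auto simp: set_add_defs)

lemma segment_Suc_mono: "segment k w \<subseteq> segment k (Suc w)"
proof
  fix x assume "x \<in> segment k w"
  then show "x \<in> segment k (Suc w)" using segment_SucI[of x k w \<zero>] by simp
qed

lemma component_segment: "k \<le> d \<Longrightarrow> d < k + w \<Longrightarrow> A d \<subseteq> segment k w"
proof (induction w)
  case (Suc w)
  show ?case
  proof (cases "d = k + w")
    case True
    then show ?thesis using segment_SucI[OF zero_segment, of _ k w] by auto
  next
    case False
    then show ?thesis using Suc segment_Suc_mono by fastforce
  qed
qed simp

text \<open>The window is widened downwards by \<open>m\<close> degrees while its upper end stays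
  fixed.\<close>

lemma segment_shift: "segment (m + k) w \<subseteq> segment k (m + w)"
proof (induction w)
  case (Suc w)
  show ?case
  proof
    fix x assume "x \<in> segment (m + k) (Suc w)"
    then obtain y z where "y \<in> segment (m + k) w" "z \<in> A (m + k + w)" "x = y \<oplus> z"
      by (rule segment_SucE)
    then show "x \<in> segment k (m + Suc w)"
      using Suc segment_SucI[of y k "m + w" z] by (auto simp: ac_simps)
  qed
qed simp

lemma component_mult_segment:
  "\<lbrakk>a \<in> A m; x \<in> segment k w\<rbrakk> \<Longrightarrow> a \<otimes> x \<in> segment (m + k) w"
proof (induction w arbitrary: x)
  case (Suc w)
  from Suc.prems(2) obtain y z where yz: "y \<in> segment k w" "z \<in> A (k + w)" "x = y \<oplus> z"
    by (rule segment_SucE)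
  have "a \<otimes> y \<oplus> a \<otimes> z \<in> segment (m + k) (Suc w)"
    using Suc.IH[OF Suc.prems(1) yz(1)] mult_component[OF Suc.prems(1) yz(2)]
    by (intro segment_SucI) (simp_all add: add.assoc)
  moreover have "a \<otimes> x = a \<otimes> y \<oplus> a \<otimes> z" using yz Suc.prems(1) by (simp add: r_distr)
  ultimately show ?case by (simp only:)
qed simp

text \<open>The degrees of \<open>s\<close> end at \<open>m - 1\<close> and those of
  \<open>x\<close> at \<open>k + w\<close>, so those of the product end at
  \<open>k + m + w - 1\<close>: the width is one less than the sum of the widths. For
  \<open>m = 0\<close> the product is zero.\<close>

lemma segment_mult:
  "\<lbrakk>s \<in> segment 0 m; x \<in> segment k (Suc w)\<rbrakk> \<Longrightarrow> s \<otimes> x \<in> segment k (m + w)"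
proof (induction m arbitrary: s)
  case 0
  then show ?case using segment_closed[OF "0"(2)] by simp
next
  case (Suc m)
  from Suc.prems(1) obtain y a where ya: "y \<in> segment 0 m" "a \<in> A (0 + m)" "s = y \<oplus> a"
    by (rule segment_SucE)
  have "y \<otimes> x \<in> segment k (Suc (m + w))"
    using Suc.IH[OF ya(1) Suc.prems(2)] segment_Suc_mono by blast
  moreover have "a \<otimes> x \<in> segment k (m + Suc w)"
    using component_mult_segment[OF ya(2) Suc.prems(2)] segment_shift[of m k "Suc w"]
    unfolding add_0 by blast
  ultimately have "y \<otimes> x \<oplus> a \<otimes> x \<in> segment k (Suc m + w)"
    by (intro add_segment) (simp_all del: segment.simps)
  moreover have "s \<otimes> x = y \<otimes> x \<oplus> a \<otimes> x"
    using ya segment_closed[OF Suc.prems(2)] by (simp add: l_distr)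
  ultimately show ?case by (simp only:)
qed

lemma segment_exhaust:
  assumes "x \<in> carrier R"
  obtains n where "x \<in> segment 0 n"
proof -
  obtain c where c: "component_family R A x c"
    using graded assms by (auto simp: graded_ring_def)
  define D where "D = {d. c d \<noteq> \<zero>}"
  have D: "finite D" "x = (\<Oplus>d\<in>D. c d)" and cA: "\<And>d. c d \<in> A d"
    using c by (auto simp: component_family_def D_def)
  obtain n where n: "D \<subseteq> {..<n}" using D(1) finite_nat_iff_bounded by blast
  from D(1) this have "(\<Oplus>d\<in>D. c d) \<in> segment 0 n"
  proof (induction D rule: finite_induct)
    case (insert d D)
    have "c d \<in> segment 0 n" using component_segment[of 0 d n] cA insert.prems by auto
    moreover have "(\<Oplus>e\<in>insert d D. c e) = c d \<oplus> (\<Oplus>e\<in>D. c e)"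
      using insert.hyps component_closed[OF cA] by (intro finsum_insert) auto
    ultimately show ?case using insert by (simp add: add_segment)
  qed simp
  then show thesis using that D(2) by blast
qed

lemma finsum_update_top:
  assumes "\<And>d. c d \<in> A d" "z \<in> A n"
  shows "(\<Oplus>d\<in>{..<Suc n}. (c(n := z)) d) = (\<Oplus>d\<in>{..<n}. c d) \<oplus> z"
proof -
  have c: "c d \<in> carrier R" for d using component_closed[OF assms(1)] .
  have "(\<Oplus>d\<in>{..<n}. (c(n := z)) d) = (\<Oplus>d\<in>{..<n}. c d)"
    using c by (intro finsum_cong') auto
  moreover have "(\<Oplus>d\<in>insert n {..<n}. (c(n := z)) d) = (c(n := z)) n \<oplus> (\<Oplus>d\<in>{..<n}. (c(n := z)) d)"
    using c component_closed[OF assms(2)] by (intro finsum_insert) auto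
  moreover have "(\<Oplus>d\<in>{..<n}. c d) \<in> carrier R"
    using c by (intro finsum_closed) auto
  ultimately show ?thesis
    using component_closed[OF assms(2)] by (simp add: lessThan_Suc a_comm)
qed

text \<open>This leads back to component families, so that their uniqueness can be applied to
  elements of a segment.\<close>

lemma segment_component_family:
  "x \<in> segment 0 n \<Longrightarrow> \<exists>c. (\<forall>d. c d \<in> A d) \<and> (\<forall>d\<ge>n. c d = \<zero>) \<and> x = (\<Oplus>d\<in>{..<n}. c d)"
proof (induction n arbitrary: x)
  case 0
  then show ?case by (intro exI[of _ "\<lambda>d. \<zero>"]) simp
next
  case (Suc n)
  from Suc.prems obtain y z where yz: "y \<in> segment 0 n" "z \<in> A (0 + n)" "x = y \<oplus> z"
    by (rule segment_SucE)
  from Suc.IH[OF yz(1)] obtain c where c: "\<And>d. c d \<in> A d" "\<And>d. d \<ge> n \<Longrightarrow> c d = \<zero>"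
    "y = (\<Oplus>d\<in>{..<n}. c d)" by blast
  have "(\<Oplus>d\<in>{..<Suc n}. (c(n := z)) d) = x"
    using finsum_update_top[of c z n] c yz by simp
  then show ?case
    using c yz(2) by (intro exI[of _ "c(n := z)"]) auto
qed

text \<open>Membership of the top component passes to all components by subtraction, so this is
  gradedness of an ideal.\<close>

definition homogeneous :: "'a set \<Rightarrow> bool" where
  "homogeneous J \<longleftrightarrow>
     ideal J R \<and> (\<forall>n. \<forall>y\<in>segment 0 n. \<forall>z\<in>A n. y \<oplus> z \<in> J \<longrightarrow> z \<in> J)"

lemma homogeneous_ideal: "homogeneous J \<Longrightarrow> ideal J R"
  by (simp add: homogeneous_def)

lemma homogeneous_top:
  "\<lbrakk>homogeneous J; y \<in> segment 0 n; z \<in> A n; y \<oplus> z \<in> J\<rbrakk> \<Longrightarrow> z \<in> J"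
  by (auto simp: homogeneous_def)

text \<open>Placing \<open>z\<close> in degree \<open>n\<close> extends the decomposition of
  \<open>y\<close> to one of \<open>y + z\<close>. By uniqueness this is also the decomposition
  inside \<open>J\<close>.\<close>

lemma graded_ideal_homogeneous:
  assumes "graded_ideal R A J"
  shows "homogeneous J"
  unfolding homogeneous_def
proof (intro conjI allI ballI impI)
  show "ideal J R" using assms by (simp add: graded_ideal_def)
next
  fix n y z assume y: "y \<in> segment 0 n" and z: "z \<in> A n" and yz: "y \<oplus> z \<in> J"
  from segment_component_family[OF y] obtain c where c: "\<And>d. c d \<in> A d"
    "\<And>d. d \<ge> n \<Longrightarrow> c d = \<zero>" "y = (\<Oplus>d\<in>{..<n}. c d)" by blast
  have "(\<Oplus>d\<in>{..<Suc n}. (c(n := z)) d) = y \<oplus> z"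
    using finsum_update_top[of c z n] c z by simp
  moreover have "component_family R A (\<Oplus>d\<in>{..<Suc n}. (c(n := z)) d) (c(n := z))"
    using c z by (intro component_family_bounded) auto
  ultimately have fam: "component_family R A (y \<oplus> z) (c(n := z))" by simp
  obtain c' where "component_family R (\<lambda>d. J \<inter> A d) (y \<oplus> z) c'"
    using assms yz by (auto simp: graded_ideal_def)
  then have c': "component_family R A (y \<oplus> z) c'" "c' n \<in> J"
    by (auto simp: component_family_def)
  from component_family_unique[OF fam c'(1)] have "c' n = z" by auto
  then show "z \<in> J" using c'(2) by simp
qed

text \<open>The cross terms of top degree are absorbed one at a time: if \<open>a\<close> is the top component of
  the multiplier and \<open>z\<close> that of \<open>x\<close>, then \<open>a z \<in> J\<close>, so that \<open>a x\<close> may be replaced by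
  \<open>a (x - z)\<close>, which has fewer components.\<close>

lemma top_component_power_mult:
  assumes J: "homogeneous J" and s: "s \<in> segment 0 m" and a: "a \<in> A m"
  shows "\<lbrakk>x \<in> segment k w; (s \<oplus> a) \<otimes> x \<in> J\<rbrakk> \<Longrightarrow> \<exists>N::nat. a [^] N \<otimes> x \<in> J"
proof (induction w arbitrary: x k)
  case 0
  interpret J: ideal J R using J by (rule homogeneous_ideal)
  from 0 show ?case by (intro exI[of _ 0]) simp
next
  case (Suc w)
  interpret J: ideal J R using J by (rule homogeneous_ideal)
  from Suc.prems(1) obtain y z where yz: "y \<in> segment k w" "z \<in> A (k + w)" "x = y \<oplus> z"
    by (rule segment_SucE)
  have carr: "s \<in> carrier R" "a \<in> carrier R" "x \<in> carrier R" "y \<in> carrier R" "z \<in> carrier R"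
    using s a yz segment_closed[OF Suc.prems(1)] by auto
  have ay: "a \<otimes> y \<in> segment (m + k) w" using a yz(1) by (rule component_mult_segment)
  \<comment> \<open>All of \<open>(s + a) x\<close> except \<open>a z\<close> has degree below
    \<open>m + k + w\<close>, so \<open>a z\<close> is its top component.\<close>
  have "s \<otimes> x \<oplus> a \<otimes> y \<in> segment k (m + w)"
    using segment_mult[OF s Suc.prems(1)] ay segment_shift by (blast intro: add_segment)
  then have "s \<otimes> x \<oplus> a \<otimes> y \<in> segment 0 (m + (k + w))"
    using segment_shift[of k 0 "m + w"] by (auto simp: ac_simps)
  moreover have "a \<otimes> z \<in> A (m + (k + w))" using a yz(2) by (rule mult_component)
  moreover have "(s \<otimes> x \<oplus> a \<otimes> y) \<oplus> a \<otimes> z = (s \<oplus> a) \<otimes> x"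
    using carr yz(3) by (simp add: l_distr r_distr a_ac)
  ultimately have az: "a \<otimes> z \<in> J"
    using J Suc.prems(2) by (auto intro: homogeneous_top)
  have "(s \<oplus> a) \<otimes> (a \<otimes> y) = a \<otimes> ((s \<oplus> a) \<otimes> x) \<ominus> (s \<oplus> a) \<otimes> (a \<otimes> z)"
    using carr yz(3) by algebra
  also have "\<dots> \<in> J"
    using az Suc.prems(2) carr by (simp add: J.I_l_closed minus_eq)
  finally have "(s \<oplus> a) \<otimes> (a \<otimes> y) \<in> J" .
  \<comment> \<open>The window of \<open>a y\<close> is one narrower than that of \<open>x\<close>
    but starts at \<open>m + k\<close>; hence the generalization over \<open>k\<close>.\<close>
  from Suc.IH[OF ay this] obtain N :: nat where N: "a [^] N \<otimes> (a \<otimes> y) \<in> J" by blast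
  have "a [^] Suc N \<otimes> x = a [^] N \<otimes> (a \<otimes> y) \<oplus> a [^] N \<otimes> (a \<otimes> z)"
    using carr yz(3) by (simp add: m_assoc r_distr)
  also have "\<dots> \<in> J" using N az carr by (simp add: J.I_l_closed)
  finally show ?case by blast
qed

text \<open>The induction hypothesis is applied to \<open>(s + a) x\<close>. After commuting
  factors, the last \<open>s + a\<close> acts on \<open>a^N x\<close>, where the case of a single
  factor applies.\<close>

lemma top_component_power_mult_of_power:
  assumes J: "homogeneous J" and s: "s \<in> segment 0 m" and a: "a \<in> A m"
  shows "\<lbrakk>x \<in> carrier R; (s \<oplus> a) [^] (n::nat) \<otimes> x \<in> J\<rbrakk> \<Longrightarrow> \<exists>N::nat. a [^] N \<otimes> x \<in> J"
proof (induction n arbitrary: x)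
  case 0
  then show ?case by (intro exI[of _ 0]) simp
next
  case (Suc n)
  have carr: "s \<in> carrier R" "a \<in> carrier R" using s a by auto
  then have "(s \<oplus> a) [^] n \<otimes> ((s \<oplus> a) \<otimes> x) \<in> J" using Suc.prems by (simp add: m_assoc)
  from Suc.IH[OF _ this] carr Suc.prems(1) obtain N :: nat
    where "a [^] N \<otimes> ((s \<oplus> a) \<otimes> x) \<in> J" by auto
  then have N: "(s \<oplus> a) \<otimes> (a [^] N \<otimes> x) \<in> J" using carr Suc.prems(1) by (simp add: m_lcomm)
  obtain w where "a [^] N \<otimes> x \<in> segment 0 w"
    using carr Suc.prems(1) segment_exhaust[of "a [^] N \<otimes> x"] by auto
  from top_component_power_mult[OF J s a this N] obtain M :: nat
    where "a [^] M \<otimes> (a [^] N \<otimes> x) \<in> J" by blast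
  then have "a [^] (M + N) \<otimes> x \<in> J"
    using carr Suc.prems(1) by (simp add: nat_pow_mult[symmetric] m_assoc)
  then show ?case by blast
qed

text \<open>An induction on the sum of the exponents replaces the binomial expansion:
  \<open>b x\<close> needs one power of \<open>b\<close> less, \<open>c x\<close> one power of
  \<open>c\<close> less, and \<open>(b - c) x\<close> is their difference.\<close>

lemma power_minus_mult_mem:
  assumes "ideal J R" "b \<in> carrier R" "c \<in> carrier R"
  shows "\<lbrakk>x \<in> carrier R; b [^] (m::nat) \<otimes> x \<in> J; c [^] (n::nat) \<otimes> x \<in> J\<rbrakk>
    \<Longrightarrow> (b \<ominus> c) [^] (m + n) \<otimes> x \<in> J"
proof (induction "m + n" arbitrary: m n x)
  case 0
  then show ?case using assms by simp
next
  case (Suc l)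
  interpret J: ideal J R by fact
  show ?case
  proof (cases "m = 0 \<or> n = 0")
    case True
    then have "x \<in> J" using Suc.prems by auto
    then show ?thesis using assms by (simp add: J.I_l_closed)
  next
    case False
    then obtain m' n' where mn: "m = Suc m'" "n = Suc n'" by (metis not0_implies_Suc)
    have x: "x \<in> carrier R" by fact
    have "b [^] m' \<otimes> (b \<otimes> x) \<in> J" "c [^] n' \<otimes> (c \<otimes> x) \<in> J"
      using Suc.prems assms by (simp_all add: mn m_assoc)
    moreover have "c [^] n \<otimes> (b \<otimes> x) \<in> J" "b [^] m \<otimes> (c \<otimes> x) \<in> J"
      using Suc.prems assms J.I_l_closed[of "c [^] n \<otimes> x" b] J.I_l_closed[of "b [^] m \<otimes> x" c]
      by (simp_all add: m_lcomm)
    ultimately have "(b \<ominus> c) [^] (m' + n) \<otimes> (b \<otimes> x) \<in> J" "(b \<ominus> c) [^] (m + n') \<otimes> (c \<otimes> x) \<in> J"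
      using Suc.hyps(1)[of m' n "b \<otimes> x"] Suc.hyps(1)[of m n' "c \<otimes> x"] Suc.hyps(2) mn x assms by auto
    then have l: "(b \<ominus> c) [^] l \<otimes> (b \<otimes> x) \<in> J" "(b \<ominus> c) [^] l \<otimes> (c \<otimes> x) \<in> J"
      using Suc.hyps(2) mn by auto
    have p: "(b \<ominus> c) [^] l \<in> carrier R" using assms by simp
    have "(b \<ominus> c) [^] Suc l \<otimes> x = (b \<ominus> c) [^] l \<otimes> ((b \<ominus> c) \<otimes> x)"
      using assms x by (simp add: m_assoc)
    also have "\<dots> = (b \<ominus> c) [^] l \<otimes> (b \<otimes> x) \<ominus> (b \<ominus> c) [^] l \<otimes> (c \<otimes> x)"
      using p assms x by algebra
    also have "\<dots> \<in> J" using l by (simp add: minus_eq)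
    finally show ?thesis using Suc.hyps(2) by simp
  qed
qed

text \<open>The elements \<open>s\<close> with \<open>s\<^sup>n x \<in> J\<close> for some \<open>n\<close> form a radical ideal containing the
  top component of each of its elements, hence all components.\<close>

lemma component_power_mult:
  assumes J: "homogeneous J" and x: "x \<in> carrier R" and P: "ideal P R"
  shows "\<lbrakk>s \<in> segment 0 m; s \<notin> P; s [^] (n::nat) \<otimes> x \<in> J\<rbrakk>
    \<Longrightarrow> \<exists>d. \<exists>t\<in>A d - P. \<exists>N::nat. t [^] N \<otimes> x \<in> J"
proof (induction m arbitrary: s n)
  case 0
  \<comment> \<open>The empty segment leaves only \<open>s = \<zero>\<close>, against
    \<open>s \<notin> P\<close>.\<close>
  then show ?case using additive_subgroup.zero_closed[OF ideal.axioms(1)[OF P]] by simp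
next
  case (Suc m)
  from Suc.prems(1) obtain y a where ya: "y \<in> segment 0 m" "a \<in> A (0 + m)" "s = y \<oplus> a"
    by (rule segment_SucE)
  then have a: "a \<in> A m" by simp
  obtain N :: nat where N: "a [^] N \<otimes> x \<in> J"
    using top_component_power_mult_of_power[OF J ya(1) a x] Suc.prems(3) ya(3) by blast
  show ?case
  proof (cases "a \<in> P")
    case False
    then show ?thesis using a N by blast
  next
    \<comment> \<open>Dropping a top component that lies in \<open>P\<close> leaves \<open>y\<close>
      outside \<open>P\<close>. A larger exponent still multiplies \<open>x\<close> into
      \<open>J\<close>, so the induction continues with \<open>y\<close>.\<close>
    case True
    have s: "s \<in> carrier R" using ya by simp
    have "s \<ominus> a = y" using ya by (simp add: minus_eq a_assoc r_neg)
    then have "y [^] (n + N) \<otimes> x \<in> J"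
      using power_minus_mult_mem[OF homogeneous_ideal[OF J] s component_closed[OF a] x Suc.prems(3) N]
      by simp
    moreover have "y \<notin> P"
      using True Suc.prems(2) ya(3) additive_subgroup.a_closed[OF ideal.axioms(1)[OF P]] by blast
    ultimately show ?thesis using Suc.IH[OF ya(1)] by blast
  qed
qed

section \<open>Homogeneous multipliers, saturations and colon ideals\<close>

text \<open>Primality keeps the powers of a homogeneous \<open>t\<close> outside \<open>P\<close>,
  so a power that multiplies \<open>x\<close> into \<open>J\<close> is itself a homogeneous
  multiplier.\<close>

lemma homogeneous_multiplier:
  assumes J: "homogeneous J" and P: "primeideal P R" and "x \<in> carrier R"
    and "s \<in> carrier R - P" "s \<otimes> x \<in> J"
  shows "\<exists>d. \<exists>t\<in>A d - P. t \<otimes> x \<in> J"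
proof -
  interpret P: primeideal P R by fact
  interpret J: ideal J R using J by (rule homogeneous_ideal)
  obtain m where m: "s \<in> segment 0 m" using assms(4) segment_exhaust by blast
  from component_power_mult[OF J assms(3) P.is_ideal m, of 1] assms(4,5)
  obtain d t and N :: nat where t: "t \<in> A d - P" and "t [^] N \<otimes> x \<in> J" by auto
  have t_carr: "t \<in> carrier R" using t by auto
  \<comment> \<open>The extra factor makes the exponent positive: the power is then a product of
    copies of \<open>t\<close>, and its homogeneity does not depend on the degree of
    \<open>\<one>\<close>.\<close>
  from \<open>t [^] N \<otimes> x \<in> J\<close> t_carr have "t \<otimes> (t [^] N \<otimes> x) \<in> J" by (rule J.I_l_closed)
  then have "t [^] Suc N \<otimes> x \<in> J" using t_carr assms(3) by (simp add: m_ac)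
  moreover have "\<exists>e. t [^] Suc N \<in> A e - P"
  proof (induction N)
    case 0
    then show ?case using t by auto
  next
    case (Suc N)
    then obtain e where "t [^] Suc N \<in> A e - P" by blast
    then have "t [^] Suc N \<otimes> t \<in> A (e + d) - P"
      using t P.I_prime[of "t [^] Suc N" t] mult_component[of "t [^] Suc N" e t d] by auto
    then show ?case by auto
  qed
  ultimately show ?thesis by blast
qed

text \<open>Multiplication by \<open>t\<close> shifts all degrees by \<open>d\<close>, so
  \<open>t z\<close> is the top component of \<open>t (y + z)\<close>.\<close>

lemma homogeneous_segment_mult:
  assumes "homogeneous J" "t \<in> A d" "y \<in> segment 0 n" "z \<in> A n" "t \<otimes> (y \<oplus> z) \<in> J"
  shows "t \<otimes> z \<in> J"
proof (rule homogeneous_top[OF assms(1)])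
  show "t \<otimes> y \<in> segment 0 (d + n)"
    using component_mult_segment[OF assms(2,3)] segment_shift[of d 0 n] by auto
  show "t \<otimes> z \<in> A (d + n)" using assms(2,4) by (rule mult_component)
  show "t \<otimes> y \<oplus> t \<otimes> z \<in> J" using assms by (simp add: r_distr)
qed

text \<open>A multiplier of \<open>y + z\<close> can be chosen homogeneous even when
  \<open>P\<close> is not graded, and a homogeneous one also multiplies the top component into
  \<open>J\<close>.\<close>

lemma saturation_homogeneous:
  assumes "homogeneous J" "primeideal P R"
  shows "homogeneous (saturation R P J)"
  unfolding homogeneous_def
proof (intro conjI allI ballI impI)
  show "ideal (saturation R P J) R"
    using assms by (intro saturation_ideal homogeneous_ideal)
next
  fix n y z assume yz: "y \<in> segment 0 n" "z \<in> A n" "y \<oplus> z \<in> saturation R P J"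
  then obtain s where "s \<in> carrier R - P" "s \<otimes> (y \<oplus> z) \<in> J" by (auto simp: saturation_def)
  with homogeneous_multiplier[OF assms, of "y \<oplus> z" s] yz
  obtain d t where "t \<in> A d - P" "t \<otimes> (y \<oplus> z) \<in> J" by auto
  then show "z \<in> saturation R P J"
    using homogeneous_segment_mult[OF assms(1), of t d y n z] yz
    by (auto simp: saturation_def intro!: bexI[of _ t])
qed

lemma colon_homogeneous:
  assumes "homogeneous J" "f \<in> A e"
  shows "homogeneous (colon R J {f})"
  unfolding homogeneous_def
proof (intro conjI allI ballI impI)
  show "ideal (colon R J {f}) R"
    using assms by (intro colon_ideal homogeneous_ideal) auto
next
  fix n y z assume yz: "y \<in> segment 0 n" "z \<in> A n" "y \<oplus> z \<in> colon R J {f}"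
  then have "f \<otimes> (y \<oplus> z) \<in> J" using assms(2) by (simp add: colon_def m_comm)
  then have "f \<otimes> z \<in> J" using homogeneous_segment_mult assms yz by blast
  then show "z \<in> colon R J {f}" using assms(2) yz by (simp add: colon_def m_comm)
qed

lemma carrier_Int_INT_homogeneous:
  assumes "\<And>P. P \<in> X \<Longrightarrow> homogeneous (F P)"
  shows "homogeneous (carrier R \<inter> (\<Inter>P\<in>X. F P))"
  unfolding homogeneous_def
proof (intro conjI allI ballI impI)
  show "ideal (carrier R \<inter> (\<Inter>P\<in>X. F P)) R"
    using assms by (intro carrier_Int_INT_ideal homogeneous_ideal)
next
  fix n y z assume "y \<in> segment 0 n" "z \<in> A n" "y \<oplus> z \<in> carrier R \<inter> (\<Inter>P\<in>X. F P)"
  then show "z \<in> carrier R \<inter> (\<Inter>P\<in>X. F P)"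
    using assms by (auto intro: homogeneous_top)
qed

section \<open>Inclusion, generation and primality tested on homogeneous elements\<close>

text \<open>An element of \<open>J\<close> is peeled off from the top degree downwards; each piece
  stays in \<open>J\<close> and so lies in \<open>K\<close>.\<close>

lemma homogeneous_subset_iff:
  assumes "homogeneous J" "ideal K R"
  shows "J \<subseteq> K \<longleftrightarrow> J \<inter> (\<Union>d. A d) \<subseteq> K"
proof
  interpret J: ideal J R using assms(1) by (rule homogeneous_ideal)
  interpret K: ideal K R by fact
  assume sub: "J \<inter> (\<Union>d. A d) \<subseteq> K"
  have "x \<in> segment 0 n \<Longrightarrow> x \<in> J \<Longrightarrow> x \<in> K" for x n
  proof (induction n arbitrary: x)
    case (Suc n)
    from Suc.prems(1) obtain y z where yz: "y \<in> segment 0 n" "z \<in> A (0 + n)" "x = y \<oplus> z"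
      by (rule segment_SucE)
    then have z: "z \<in> J" using Suc.prems(2) homogeneous_top[OF assms(1), of y n z] by simp
    have "y = x \<ominus> z" using yz by (simp add: minus_eq a_assoc r_neg)
    then have "y \<in> J" using Suc.prems(2) z by (simp add: minus_eq)
    then have "y \<in> K" using Suc.IH yz(1) by blast
    moreover have "z \<in> K" using sub z yz(2) by blast
    ultimately show ?case using yz(3) by simp
  qed simp
  then show "J \<subseteq> K" using segment_exhaust J.Icarr by blast
qed blast

lemma homogeneous_eq_Idl:
  assumes "homogeneous J"
  shows "Idl (J \<inter> (\<Union>d. A d)) = J"
proof
  interpret J: ideal J R using assms by (rule homogeneous_ideal)
  have carr: "J \<inter> (\<Union>d. A d) \<subseteq> carrier R" by auto
  show "Idl (J \<inter> (\<Union>d. A d)) \<subseteq> J" by (intro genideal_minimal J.is_ideal) auto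
  show "J \<subseteq> Idl (J \<inter> (\<Union>d. A d))"
    unfolding homogeneous_subset_iff[OF assms genideal_ideal[OF carr]]
    by (rule genideal_self[OF carr])
qed

lemma homogeneous_primeI:
  assumes Q: "homogeneous Q" and "Q \<noteq> carrier R"
    and prime: "\<And>d e a b. \<lbrakk>a \<in> A d; b \<in> A e; a \<otimes> b \<in> Q\<rbrakk> \<Longrightarrow> a \<in> Q \<or> b \<in> Q"
  shows "primeideal Q R"
proof (rule primeidealI)
  interpret Q: ideal Q R using Q by (rule homogeneous_ideal)
  show "ideal Q R" by (rule Q.is_ideal)
  show "cring R" by (rule cring_axioms)
  show "carrier R \<noteq> Q" using assms(2) by simp
  fix x y assume xy: "x \<in> carrier R" "y \<in> carrier R" "x \<otimes> y \<in> Q"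
  \<comment> \<open>A homogeneous \<open>t\<close> outside \<open>Q\<close> cancels: it multiplies
    each component of \<open>v\<close> into \<open>Q\<close>, and \<open>prime\<close> then puts
    that component in \<open>Q\<close>.\<close>
  have cancel: "v \<in> Q" if t: "t \<in> A d - Q" and "v \<in> carrier R" "t \<otimes> v \<in> Q" for t d v
  proof -
    have "v \<in> segment 0 n \<Longrightarrow> t \<otimes> v \<in> Q \<Longrightarrow> v \<in> Q" for v n
    proof (induction n arbitrary: v)
      case (Suc n)
      from Suc.prems(1) obtain y z where yz: "y \<in> segment 0 n" "z \<in> A (0 + n)" "v = y \<oplus> z"
        by (rule segment_SucE)
      have tz: "t \<otimes> z \<in> Q"
        using homogeneous_segment_mult[OF Q, of t d y n z] t yz Suc.prems(2) by simp
      then have z: "z \<in> Q" using prime[of t d z] t yz(2) by blast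
      have "t \<in> carrier R" "y \<in> carrier R" "z \<in> carrier R" using t yz by auto
      then have "t \<otimes> y = t \<otimes> v \<ominus> t \<otimes> z"
        unfolding yz(3) by (simp add: minus_eq a_assoc r_neg r_distr)
      then have "t \<otimes> y \<in> Q" using tz Suc.prems(2) by (simp add: minus_eq)
      then show ?case using Suc.IH yz z by simp
    qed simp
    then show ?thesis using that segment_exhaust by blast
  qed
  show "x \<in> Q \<or> y \<in> Q"
  proof (rule disjCI)
    assume "y \<notin> Q"
    show "x \<in> Q"
    proof (rule ccontr)
      assume "x \<notin> Q"
      obtain m where m: "x \<in> segment 0 m" using xy(1) segment_exhaust by blast
      \<comment> \<open>Here \<open>Q\<close> is both the target ideal and the ideal to be avoided.
        The multiplier \<open>x\<close> is traded for powers of a homogeneous \<open>t\<close>,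
        whose factors are then cancelled one by one.\<close>
      from component_power_mult[OF Q xy(2) Q.is_ideal m \<open>x \<notin> Q\<close>, of 1] xy
      obtain d t and N :: nat where t: "t \<in> A d - Q" and N: "t [^] N \<otimes> y \<in> Q" by auto
      from N have "y \<in> Q"
      proof (induction N)
        case (Suc N)
        have t_carr: "t \<in> carrier R" using t by auto
        have "t \<otimes> (t [^] N \<otimes> y) \<in> Q" using Suc.prems t_carr xy(2) by (simp add: m_ac)
        moreover have "t [^] N \<otimes> y \<in> carrier R" using t_carr xy(2) by simp
        ultimately show ?case using cancel[OF t] Suc.IH by blast
      qed (use xy(2) in simp)
      then show False using \<open>y \<notin> Q\<close> by blast
    qed
  qed
qed

end

section \<open>Generator degrees and the v-number\<close>

locale graded_noetherian_domain = graded_cring R A + noetherian_domain R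
  for R (structure) and A
begin

lemma carrier_homogeneous: "homogeneous (carrier R)"
  using oneideal by (auto simp: homogeneous_def)

lemma exists_homogeneous_prime_colon:
  assumes J: "homogeneous J" and "J \<noteq> carrier R"
  shows "\<exists>d. \<exists>f\<in>A d. primeideal (colon R J {f}) R"
proof -
  interpret J: ideal J R using J by (rule homogeneous_ideal)
  let ?X = "{colon R J {f} | f. f \<in> (\<Union>d. A d) - J}"
  have "\<not> carrier R \<subseteq> J" using assms(2) J.a_subset by blast
  \<comment> \<open>An ideal containing all homogeneous elements would be \<open>R\<close>, so some
    homogeneous \<open>f\<close> lies outside \<open>J\<close>.\<close>
  then have "?X \<noteq> {}" using homogeneous_subset_iff[OF carrier_homogeneous J.is_ideal] by blast
  then have "\<exists>M\<in>?X. \<forall>K\<in>?X. M \<subseteq> K \<longrightarrow> K = M"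
    by (rule exists_maximal_ideal_in) (auto intro!: colon_ideal J.is_ideal)
  then obtain M where M: "M \<in> ?X" and max: "\<forall>K\<in>?X. M \<subseteq> K \<longrightarrow> K = M" ..
  from M obtain f d where f: "f \<in> A d" "f \<notin> J" and M_eq: "M = colon R J {f}" by blast
  have "primeideal M R"
  proof (rule homogeneous_primeI)
    show "homogeneous M" unfolding M_eq using J f(1) by (rule colon_homogeneous)
    show "M \<noteq> carrier R" unfolding M_eq using colon_eq_carrier_iff[OF J.is_ideal, of "{f}"] f by auto
  next
    fix i j a b assume ab: "a \<in> A i" "b \<in> A j" "a \<otimes> b \<in> M"
    have carr: "a \<in> carrier R" "b \<in> carrier R" "f \<in> carrier R" using ab f(1) by auto
    show "a \<in> M \<or> b \<in> M"
    proof (rule disjCI)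
      assume "b \<notin> M"
      then have "b \<otimes> f \<notin> J" using carr by (simp add: M_eq colon_def)
      \<comment> \<open>Since \<open>b f\<close> is again homogeneous and outside \<open>J\<close>,
        its colon ideal competes with \<open>M\<close>. Maximality makes the two equal, and
        \<open>a b f \<in> J\<close> puts \<open>a\<close> in them.\<close>
      then have X: "colon R J {b \<otimes> f} \<in> ?X" using mult_component[OF ab(2) f(1)] by blast
      have "M \<subseteq> colon R J {b \<otimes> f}"
        unfolding M_eq using carr J.I_l_closed by (auto simp: colon_def m_lcomm[of _ b f])
      with bspec[OF max X] have "colon R J {b \<otimes> f} = M" by (rule mp)
      moreover have "a \<in> colon R J {b \<otimes> f}"
        using ab(3) carr by (simp add: M_eq colon_def m_assoc)
      ultimately show "a \<in> M" by simp
    qed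
  qed
  then show ?thesis using f(1) M_eq by blast
qed

section \<open>Minimal homogeneous generating sets\<close>

lemma
  assumes "minimal_homogeneous_generators R A J G"
  shows minimal_homogeneous_generators_components: "G \<subseteq> (\<Union>d. A d)"
    and minimal_homogeneous_generators_Idl: "Idl G = J"
    and minimal_homogeneous_generators_minimal: "H \<subset> G \<Longrightarrow> Idl H \<noteq> J"
  using assms unfolding minimal_homogeneous_generators_def by simp_all

lemma minimal_homogeneous_generators_carrier:
  assumes "minimal_homogeneous_generators R A J G"
  shows "G \<subseteq> carrier R"
proof -
  have "(\<Union>d. A d) \<subseteq> carrier R" using component_carrier by (rule UN_least)
  with minimal_homogeneous_generators_components[OF assms] show ?thesis by (rule subset_trans)
qed

text \<open>A finite homogeneous generating set of least cardinality is minimal for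
  inclusion.\<close>

lemma exists_minimal_homogeneous_generators:
  assumes "homogeneous J"
  shows "\<exists>G. minimal_homogeneous_generators R A J G"
proof -
  define generating where
    "generating G \<longleftrightarrow> G \<subseteq> J \<inter> (\<Union>d. A d) \<and> finite G \<and> Idl G = J" for G
  have "J \<inter> (\<Union>d. A d) \<subseteq> carrier R" using component_carrier by blast
  from finite_generating_subset[OF this] obtain G0
    where "G0 \<subseteq> J \<inter> (\<Union>d. A d)" "finite G0" "Idl G0 = J"
    unfolding homogeneous_eq_Idl[OF assms] by (elim exE conjE)
  then have "generating G0" unfolding generating_def by (intro conjI)
  from ex_has_least_nat[of generating G0 card, OF this]
  obtain G where G: "generating G" and least: "\<And>H. generating H \<Longrightarrow> card G \<le> card H"
    by blast
  have finG: "finite G" and GJ: "G \<subseteq> J \<inter> (\<Union>d. A d)" and gen: "Idl G = J"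
    using G by (simp_all add: generating_def)
  have "Idl H \<noteq> J" if H: "H \<subset> G" for H
  proof
    assume "Idl H = J"
    moreover have "finite H" using H finG finite_subset by blast
    moreover have "H \<subseteq> J \<inter> (\<Union>d. A d)" using H GJ by blast
    ultimately have "generating H" by (simp add: generating_def)
    then have "card G \<le> card H" by (rule least)
    then show False using psubset_card_mono[OF finG H] by simp
  qed
  moreover have "G \<subseteq> (\<Union>d. A d)" using GJ by blast
  ultimately have "minimal_homogeneous_generators R A J G"
    using gen unfolding minimal_homogeneous_generators_def by simp
  then show ?thesis ..
qed

lemma minimal_homogeneous_generators_finite:
  assumes "minimal_homogeneous_generators R A J G"
  shows "finite G"
proof -
  from finite_generating_subset[OF minimal_homogeneous_generators_carrier[OF assms]]
  obtain H where H: "H \<subseteq> G" "finite H" "Idl H = J"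
    unfolding minimal_homogeneous_generators_Idl[OF assms] by (elim exE conjE)
  have "H = G"
  proof (rule ccontr)
    assume "H \<noteq> G"
    then have "H \<subset> G" using H(1) by (simp add: psubset_eq)
    from minimal_homogeneous_generators_minimal[OF assms this] show False using H(3) by simp
  qed
  then show ?thesis using H(2) by simp
qed

text \<open>Removing zero would not change the ideal. A nonzero generator has a single degree, which
  later keeps the set of degrees finite.\<close>

lemma minimal_homogeneous_generators_zero:
  assumes "minimal_homogeneous_generators R A J G"
  shows "\<zero> \<notin> G"
proof
  assume zero: "\<zero> \<in> G"
  have carr: "G \<subseteq> carrier R" by (rule minimal_homogeneous_generators_carrier[OF assms])
  then have sub: "G - {\<zero>} \<subseteq> carrier R" by blast
  interpret I: ideal "Idl (G - {\<zero>})" R using sub by (rule genideal_ideal)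
  have "G \<subseteq> Idl (G - {\<zero>})"
  proof
    fix g assume "g \<in> G"
    then show "g \<in> Idl (G - {\<zero>})"
      using subsetD[OF genideal_self[OF sub], of g] I.zero_closed by (cases "g = \<zero>") simp_all
  qed
  then have "Idl G \<subseteq> Idl (G - {\<zero>})" by (intro genideal_minimal I.is_ideal)
  moreover have "Idl (G - {\<zero>}) \<subseteq> Idl G" using carr by (intro subset_Idl_subset) auto
  ultimately have "Idl (G - {\<zero>}) = J"
    unfolding minimal_homogeneous_generators_Idl[OF assms] by (intro subset_antisym)
  moreover have "G - {\<zero>} \<subset> G" using zero by blast
  ultimately show False using minimal_homogeneous_generators_minimal[OF assms] by simp
qed

text \<open>\<open>Max\<close> bounds the degrees once there are finitely many of them: the
  generators are finite in number and each has one degree. For \<open>J = {\<zero>}\<close> the set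
  \<open>G\<close> is empty and the bound is vacuous.\<close>

lemma max_gen_degree_generators:
  assumes "homogeneous J"
  obtains G where "finite G" "G \<subseteq> carrier R" "Idl G = J"
    "\<And>g. g \<in> G \<Longrightarrow> \<exists>d\<le>max_gen_degree R A J. g \<in> A d"
proof -
  \<comment> \<open>The choice made in \<open>max_gen_degree\<close> is repeated, so that its
    maximum ranges over the degrees of this \<open>G\<close>.\<close>
  define G where "G = (SOME G. minimal_homogeneous_generators R A J G)"
  have G: "minimal_homogeneous_generators R A J G"
    unfolding G_def using exists_minimal_homogeneous_generators[OF assms] by (rule someI_ex)
  have "finite {d. g \<in> A d}" if "g \<in> G" for g
  proof -
    have "g \<noteq> \<zero>" using that minimal_homogeneous_generators_zero[OF G] by metis
    then have "d = e" if "g \<in> A d" "g \<in> A e" for d e using degree_unique that by metis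
    then have "{d. g \<in> A d} \<subseteq> {THE d. g \<in> A d}" by (auto intro!: the_equality[symmetric])
    then show ?thesis by (rule finite_subset) simp
  qed
  then have "finite (\<Union>g\<in>G. {d. g \<in> A d})"
    using minimal_homogeneous_generators_finite[OF G] by simp
  moreover have "(\<Union>g\<in>G. {d. g \<in> A d}) = {d. \<exists>g\<in>G. g \<in> A d}" by blast
  ultimately have fin: "finite {d. \<exists>g\<in>G. g \<in> A d}" by simp
  show thesis
  proof (rule that)
    show "finite G" by (rule minimal_homogeneous_generators_finite[OF G])
    show "G \<subseteq> carrier R" by (rule minimal_homogeneous_generators_carrier[OF G])
    show "Idl G = J" by (rule minimal_homogeneous_generators_Idl[OF G])
    fix g assume g: "g \<in> G"
    then obtain d where d: "g \<in> A d" using minimal_homogeneous_generators_components[OF G] by blast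
    have "d \<in> {d. \<exists>g\<in>G. g \<in> A d}" using g d by blast
    with fin have "d \<le> max_gen_degree R A J"
      unfolding max_gen_degree_def G_def[symmetric] by (rule Max_ge)
    then show "\<exists>d\<le>max_gen_degree R A J. g \<in> A d" using d by blast
  qed
qed

section \<open>Induction on the exponent\<close>

lemma prime_colon_step:
  assumes J: "ideal J R" and L: "homogeneous L"
    and f: "f \<in> A e" "primeideal (colon R (colon R J L) {f}) R"
  shows "\<exists>d\<le>max_gen_degree R A L + e. \<exists>h\<in>A d. primeideal (colon R J {h}) R"
proof -
  obtain G where G: "finite G" "G \<subseteq> carrier R" "Idl G = L"
    and deg: "\<And>g. g \<in> G \<Longrightarrow> \<exists>d\<le>max_gen_degree R A L. g \<in> A d"
    by (rule max_gen_degree_generators[OF L]) (rule that)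
  have "colon R J L = colon R J G" using colon_Idl[OF J G(2)] G(3) by simp
  then have "\<exists>g\<in>G. colon R (colon R J L) {f} = colon R J {g \<otimes> f}"
    by (intro prime_eq_colon_generator[OF f(2) J G(1,2) component_closed[OF f(1)]]) simp
  then obtain g where g: "g \<in> G" "primeideal (colon R J {g \<otimes> f}) R"
    using f(2) by auto
  from deg[OF g(1)] obtain d where d: "d \<le> max_gen_degree R A L" "g \<in> A d" by blast
  have "g \<otimes> f \<in> A (d + e)" using d(2) f(1) by (rule mult_component)
  then show ?thesis using g(2) d(1) by (intro exI[of _ "d + e"]) auto
qed

text \<open>Gradedness of the first symbolic power supplies the homogeneous generators for each step
  and the prime colon ideal at the start.\<close>

lemma symbolic_power_1_homogeneous:
  assumes "homogeneous J"
  shows "homogeneous (symbolic_power R conv J 1)"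
  unfolding symbolic_power_eq[OF homogeneous_ideal[OF assms] order_refl]
    ideal_power_1[OF homogeneous_ideal[OF assms]]
  by (intro carrier_Int_INT_homogeneous saturation_homogeneous assms symbolic_primes_prime)

lemma v_number_symbolic_power_le:
  assumes J: "homogeneous J" and persistence: "symbolic_strong_persistence R conv J"
    and "k \<ge> 1"
  shows "v_number R A (symbolic_power R conv J k)
    \<le> (k - 1) * max_gen_degree R A (symbolic_power R conv J 1)
      + v_number R A (symbolic_power R conv J 1)"
proof -
  define S where "S = symbolic_power R conv J"
  have S_ideal: "ideal (S k) R" for k
    unfolding S_def by (intro symbolic_power_ideal homogeneous_ideal J)
  have S1: "homogeneous (S 1)"
    unfolding S_def using J by (rule symbolic_power_1_homogeneous)
  have colon_S: "colon R (S (Suc k)) (S 1) = S k" for k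
    using persistence by (simp add: symbolic_strong_persistence_def S_def)
  have v: "v_number R A (S k) = (LEAST d. \<exists>f\<in>A d. primeideal (colon R (S k) {f}) R)" for k
    by (intro v_number_eq S_ideal component_carrier)
  show ?thesis
  proof (cases "S 1 = carrier R")
    case True
    \<comment> \<open>Starting from \<open>S 0 = R\<close>, the equation
      \<open>(S (Suc k) : R) = R\<close> forces \<open>R \<subseteq> S (Suc k)\<close>.\<close>
    have "S k = carrier R" for k
    proof (induction k)
      case 0
      then show ?case by (simp add: S_def symbolic_power_def)
    next
      case (Suc k)
      then have "carrier R \<subseteq> S (Suc k)"
        using colon_S[of k] True colon_eq_carrier_iff[OF S_ideal[of "Suc k"], of "carrier R"] by simp
      then show ?case using additive_subgroup.a_subset[OF ideal.axioms(1)[OF S_ideal]] by blast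
    qed
    then show ?thesis by (simp add: S_def)
  next
    case False
    \<comment> \<open>Here \<open>j\<close> is \<open>k - 1\<close>. The degree \<open>d\<close> is
      only bounded, since the generator found in a step may have less than the maximal
      degree.\<close>
    have "\<exists>d\<le>j * max_gen_degree R A (S 1) + v_number R A (S 1).
        \<exists>f\<in>A d. primeideal (colon R (S (Suc j)) {f}) R" for j
    proof (induction j)
      case 0
      \<comment> \<open>As \<open>S 1\<close> is proper, the least degree is attained.\<close>
      have "\<exists>f\<in>A (v_number R A (S 1)). primeideal (colon R (S 1) {f}) R"
        unfolding v using exists_homogeneous_prime_colon[OF S1 False] by (rule LeastI_ex)
      then show ?case by auto
    next
      case (Suc j)
      then obtain e f where e: "e \<le> j * max_gen_degree R A (S 1) + v_number R A (S 1)"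
        and f: "f \<in> A e" "primeideal (colon R (S (Suc j)) {f}) R" by blast
      \<comment> \<open>For \<open>J = S (Suc (Suc j))\<close> persistence identifies
        \<open>(J : S 1)\<close> with \<open>S (Suc j)\<close>, where \<open>f\<close> has a prime
        colon ideal.\<close>
      from prime_colon_step[OF S_ideal S1 f(1), of "Suc (Suc j)"] f(2)
      obtain d where "d \<le> max_gen_degree R A (S 1) + e"
        "\<exists>h\<in>A d. primeideal (colon R (S (Suc (Suc j))) {h}) R"
        unfolding colon_S by blast
      then show ?case using e by (intro exI[of _ d]) auto
    qed
    from this[of "k - 1"] obtain d
      where d: "d \<le> (k - 1) * max_gen_degree R A (S 1) + v_number R A (S 1)"
        "\<exists>f\<in>A d. primeideal (colon R (S k) {f}) R" using \<open>k \<ge> 1\<close> by auto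
    have "v_number R A (S k) \<le> d" unfolding v using d(2) by (rule Least_le)
    then show ?thesis using d(1) by (simp add: S_def)
  qed
qed

end

theorem theorem4p4:
  fixes R :: "('a, 'b) ring_scheme"
    and A :: "nat \<Rightarrow> 'a set"
    and I :: "'a set"
    and conv :: symbolic_convention
  assumes "noetherian_domain R"
    and "graded_ring R A"
    and "graded_ideal R A I"
    and "I \<noteq> carrier R"
    and "symbolic_strong_persistence R conv I"
  shows "\<forall>k\<ge>1. v_number R A (symbolic_power R conv I k)
           \<le> (k - 1) * max_gen_degree R A (symbolic_power R conv I 1)
              + v_number R A (symbolic_power R conv I 1)"
proof -
  interpret noetherian_domain R by fact
  interpret graded_noetherian_domain R A
    by unfold_locales fact
  show ?thesis
    using v_number_symbolic_power_le[OF graded_ideal_homogeneous] assms by blast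
qed

end
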